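(* Let $f$ be an expanding Lorenz map with critical point $c$ and with a primary $n(k)$-cycle $$z_0<z_1<\dots<z_{n-k-1}<c<z_{n-k}<\dots<z_{n-1}.$$ Then the following conditions hold. (1) The map $g\colon[u,v]\to[u,v]$, where $[u,v]:=[f^{n-1}(0),f^{n-1}(1)]$, given by $$g(x)=\begin{cases}f^n(x),& x\in[u,c)\\ f^n(x),& x\in(c,v]\end{cases}$$ is a well defined expanding Lorenz map (on $[u,v]$) and is a renormalization of $f$. (2) If $\tilde g=(f^l,f^r)$ is a renormalization of $f$ and at least one of the numbers $l$ and $r$ is greater than or equal to $n$, then $n$ divides both $l$ and $r$. (3) If $z_{k-1}=f(0)$ or $z_k=f(1)$, then $\hat F_g$ is not completely invariant under $\hat f$. (4) If $z_{k-1}\neq f(0)$ and $z_k\neq f(1)$, then: (a) $J_g$ is a completely invariant (under $f$) proper subset of $[0,1]$; (b) $z_{n-k-1}=\sup\{x\in J_g: x<c\}$ and $z_{n-k}=\inf\{x\in J_g: x>c\}$; (c) $R_{J_g}f=g$.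
   Context: **Expanding Lorenz map.** A map $f\colon[0,1]\to[0,1]$ such that: (i) there is a critical point $c\in(0,1)$ such that $f$ is continuous and strictly increasing on $[0,c)$ and on $(c,1]$; (ii) $\lim_{x\to c^-}f(x)=1$ and $\lim_{x\to c^+}f(x)=0$; (iii) $f$ is differentiable outside a finite set $F\subseteq[0,1]$ and $\inf_{x\notin F}f'(x)>1$. The value $f(c)$ is taken to be $0$ or $1$ (either choice). $f^n(a_+)$, $f^n(a_-)$ denote the right and left one-sided limits of $f^n$ at $a$. $\mathrm{Orb}(x)$ is the forward orbit of $x$, including $x$. **Primary $n(k)$-cycle.** A sequence $\{z_j\}_{j=0}^{n-1}$ is an $n(k)$-cycle if $z_0<\dots<z_{n-k-1}<c<z_{n-k}<\dots<z_{n-1}$ (so $1\le k\le n-1$), $f(z_j)=z_{j+k\ (\mathrm{mod}\ n)}$ for all $j$, and $k,n$ are coprime. It is primary if in addition $z_{k-1}\le f(0)$ and $f(1)\le z_k$. **Doubled space.** Let $A=\left(\bigcup_{n\ge0}f^{-n}(c)\right)\setminus\{0,1\}$. The space $\mathbb{X}$ is obtained from $[0,1]$ by replacing each $a\in A$ by two points $a_-<a_+$, with the induced linear order and the order topology; it is a Cantor set. The continuous map $\hat f\colon\mathbb{X}\to\mathbb{X}$ is given by: $\hat f(c_-)=1$, $\hat f(c_+)=0$; $\hat f(a_\pm)=f(a)_\pm$ for $a\in A\setminus\{c\}$; $\hat f(x)=f(x)$ for $x\in[0,1]\setminus(A\cup\{0,1\})$; $\hat f(0)=f(0)_+$ if $f(0)\in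 A$ and $\hat f(0)=f(0)$ otherwise; $\hat f(1)=f(1)_-$ if $f(1)\in A$ and $\hat f(1)=f(1)$ otherwise. **Renormalization.** A map $g$ is a(n expanding) Lorenz map on $[u,v]$ if conjugating it by the increasing linear homeomorphism $[u,v]\to[0,1]$ gives an expanding Lorenz map on $[0,1]$. If there are a proper subinterval $(u,v)\ni c$ of $(0,1)$ and integers $l,r>1$ such that $g\colon[u,v]\to[u,v]$, $g(x)=f^l(x)$ for $x\in[u,c)$, $g(x)=f^r(x)$ for $x\in(c,v]$, is a Lorenz map on $[u,v]$ (with critical point $c$), then $g$ is a renormalization of $f$, written $g=(f^l,f^r)$; necessarily $[u,v]=[f^r(c_+),f^l(c_-)]$. If the orbit of $0$ or $1$ hits $c$, the endpoint values are understood as $g(u)=f^l(u_+)$ and $g(v)=f^r(v_-)$. **The sets $\hat F_g$, $J_g$.** For a renormalization $g=(f^l,f^r)$ with interval $[u,v]$: $F_g=\{x\in[0,1]:\mathrm{Orb}(x)\cap(u,v)\ne\emptyset\}$, $J_g=[0,1]\setminus F_g$, and $\hat F_g=\{x\in\mathbb{X}:\mathrm{Orb}_{\hat f}(x)\cap(\hat f^r(c_+),\hat f^l(c_-))\neq\emptyset\}$. **Complete invariance.** A nonempty $E\subset[0,1]$ is completely invariant under $f$ if $f(E)=E=f^{-1}(E)$; a nonempty $\hat E\subset\mathbb{X}$ is completely invariant under $\hat f$ if $\hat f(\hat E)=\hat E=\hat f^{-1}(\hat E)$. **The map $R_Ef$.** For a nonempty open interval $U\subset[0,1]$ let $N(U)=\min\{n\ge0: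 f^n(z)=c\text{ for some }z\in U\}$. For a closed set $E\subset[0,1]$ put $e_-=\sup\{x\in E:x<c\}$, $e_+=\inf\{x\in E:x>c\}$, $l=N((e_-,c))$, $r=N((c,e_+))$, and $$R_Ef(x)=\begin{cases}f^l(x),&x\in[f^r(c_+),c)\\ f^r(x),&x\in(c,f^l(c_-)].\end{cases}$$ *)

theory Defs
  imports "HOL-Analysis.Analysis"
begin

section \<open>Lorenz maps\<close>

text \<open>
  A map on $[0,1]$ is a function \<open>real \<Rightarrow> real\<close> of which only the values on \<open>{0..1}\<close> matter; in
  particular derivatives are taken within \<open>{0..1}\<close>. The infimum below is that of a nonempty set
  which is bounded below (a derivative of an increasing function is nonnegative, and \<open>c \<in> F\<close>
  because \<open>f\<close> jumps at \<open>c\<close>), so the real-valued \<open>INF\<close> is the honest one.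
\<close>

definition expanding_lorenz_map :: "(real \<Rightarrow> real) \<Rightarrow> real \<Rightarrow> bool" where
  "expanding_lorenz_map f c \<longleftrightarrow>
     f ` {0..1} \<subseteq> {0..1} \<and>
     c \<in> {0<..<1} \<and>
     continuous_on {0..<c} f \<and> strict_mono_on {0..<c} f \<and>
     continuous_on {c<..1} f \<and> strict_mono_on {c<..1} f \<and>
     (f \<longlongrightarrow> 1) (at_left c) \<and> (f \<longlongrightarrow> 0) (at_right c) \<and>
     (\<exists>F f'. finite F \<and> F \<subseteq> {0..1} \<and>
        (\<forall>x\<in>{0..1} - F. (f has_real_derivative f' x) (at x within {0..1})) \<and>
        (INF x\<in>{0..1} - F. f' x) > 1) \<and>
     f c \<in> {0, 1}"

definition expanding_lorenz_map_on :: "real \<Rightarrow> real \<Rightarrow> (real \<Rightarrow> real) \<Rightarrow> real \<Rightarrow> bool" where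
  "expanding_lorenz_map_on u v g c \<longleftrightarrow>
     u < v \<and>
     expanding_lorenz_map (\<lambda>t. (g (u + (v - u) * t) - u) / (v - u)) ((c - u) / (v - u))"

definition right_lim :: "(real \<Rightarrow> real) \<Rightarrow> real \<Rightarrow> real" where
  "right_lim h a = Lim (at_right a) h"

definition left_lim :: "(real \<Rightarrow> real) \<Rightarrow> real \<Rightarrow> real" where
  "left_lim h a = Lim (at_left a) h"

definition forward_orbit :: "('a \<Rightarrow> 'a) \<Rightarrow> 'a \<Rightarrow> 'a set" where
  "forward_orbit h x = {(h ^^ m) x | m. True}"

definition completely_invariant :: "'a set \<Rightarrow> ('a \<Rightarrow> 'a) \<Rightarrow> 'a set \<Rightarrow> bool" where
  "completely_invariant S h E \<longleftrightarrow>
     E \<subseteq> S \<and> E \<noteq> {} \<and> h ` E = E \<and> {x \<in> S. h x \<in> E} = E"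


section \<open>Primary cycles\<close>

definition nk_cycle :: "(real \<Rightarrow> real) \<Rightarrow> real \<Rightarrow> nat \<Rightarrow> nat \<Rightarrow> (nat \<Rightarrow> real) \<Rightarrow> bool" where
  "nk_cycle f c n k z \<longleftrightarrow>
     1 \<le> k \<and> k \<le> n - 1 \<and> coprime k n \<and>
     (\<forall>j<n. z j \<in> {0..1}) \<and> strict_mono_on {..<n} z \<and>
     z (n - k - 1) < c \<and> c < z (n - k) \<and>
     (\<forall>j<n. f (z j) = z ((j + k) mod n))"

definition primary_nk_cycle :: "(real \<Rightarrow> real) \<Rightarrow> real \<Rightarrow> nat \<Rightarrow> nat \<Rightarrow> (nat \<Rightarrow> real) \<Rightarrow> bool" where
  "primary_nk_cycle f c n k z \<longleftrightarrow> nk_cycle f c n k z \<and> z (k - 1) \<le> f 0 \<and> f 1 \<le> z k"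


section \<open>Renormalizations\<close>

text \<open>
  \<open>g\<close> is the renormalization $(f^l, f^r)$ of \<open>f\<close> on $[u,v]$. Its value at \<open>c\<close> is \<open>u\<close> or \<open>v\<close>
  (either choice), by the convention contained in \<^const>\<open>expanding_lorenz_map\<close>.
\<close>

definition renormalization ::
    "(real \<Rightarrow> real) \<Rightarrow> real \<Rightarrow> nat \<Rightarrow> nat \<Rightarrow> real \<Rightarrow> real \<Rightarrow> (real \<Rightarrow> real) \<Rightarrow> bool" where
  "renormalization f c l r u v g \<longleftrightarrow>
     l > 1 \<and> r > 1 \<and>
     c \<in> {u<..<v} \<and> {u<..<v} \<subset> {0<..<1} \<and>
     (\<forall>x\<in>{u<..<c}. g x = (f ^^ l) x) \<and>
     (\<forall>x\<in>{c<..<v}. g x = (f ^^ r) x) \<and>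
     g u = (if c \<in> forward_orbit f 0 \<union> forward_orbit f 1
            then right_lim (f ^^ l) u else (f ^^ l) u) \<and>
     g v = (if c \<in> forward_orbit f 0 \<union> forward_orbit f 1
            then left_lim (f ^^ r) v else (f ^^ r) v) \<and>
     expanding_lorenz_map_on u v g c"

definition F_set :: "(real \<Rightarrow> real) \<Rightarrow> real \<Rightarrow> real \<Rightarrow> real set" where
  "F_set f u v = {x \<in> {0..1}. forward_orbit f x \<inter> {u<..<v} \<noteq> {}}"

definition J_set :: "(real \<Rightarrow> real) \<Rightarrow> real \<Rightarrow> real \<Rightarrow> real set" where
  "J_set f u v = {0..1} - F_set f u v"


section \<open>The map $R_E f$\<close>

definition first_hit :: "(real \<Rightarrow> real) \<Rightarrow> real \<Rightarrow> real set \<Rightarrow> nat" where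
  "first_hit f c U = (LEAST m. \<exists>x\<in>U. (f ^^ m) x = c)"

definition e_minus :: "real \<Rightarrow> real set \<Rightarrow> real" where
  "e_minus c E = Sup {x \<in> E. x < c}"

definition e_plus :: "real \<Rightarrow> real set \<Rightarrow> real" where
  "e_plus c E = Inf {x \<in> E. x > c}"

text \<open>A partial function, so that equality of maps includes equality of their domains.\<close>

definition R_map :: "(real \<Rightarrow> real) \<Rightarrow> real \<Rightarrow> real set \<Rightarrow> real \<rightharpoonup> real" where
  "R_map f c E =
     (let l = first_hit f c {e_minus c E<..<c};
          r = first_hit f c {c<..<e_plus c E}
      in (\<lambda>x. if x \<in> {right_lim (f ^^ r) c..<c} then Some ((f ^^ l) x)
              else if x \<in> {c<..left_lim (f ^^ l) c} then Some ((f ^^ r) x)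
              else None))"


section \<open>The doubled space\<close>

definition precritical :: "(real \<Rightarrow> real) \<Rightarrow> real \<Rightarrow> real set" where
  "precritical f c = (\<Union>m. {x \<in> {0..1}. (f ^^ m) x = c}) - {0, 1}"

text \<open>
  \<open>Pt x\<close> is an undoubled point, \<open>PtMinus a\<close> and \<open>PtPlus a\<close> are the two copies $a_- < a_+$. The
  topology of the doubled space is not needed: complete invariance, orbits and order intervals
  involve only the set, its order and the map.
\<close>

datatype doubled_point = Pt real | PtMinus real | PtPlus real

fun base :: "doubled_point \<Rightarrow> real" where
  "base (Pt x) = x"
| "base (PtMinus a) = a"
| "base (PtPlus a) = a"

fun side :: "doubled_point \<Rightarrow> int" where
  "side (Pt x) = 0"
| "side (PtMinus a) = -1"
| "side (PtPlus a) = 1"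

definition doubled_less :: "doubled_point \<Rightarrow> doubled_point \<Rightarrow> bool" where
  "doubled_less p q \<longleftrightarrow> base p < base q \<or> (base p = base q \<and> side p < side q)"

definition doubled_space :: "(real \<Rightarrow> real) \<Rightarrow> real \<Rightarrow> doubled_point set" where
  "doubled_space f c =
     Pt ` ({0..1} - precritical f c) \<union> PtMinus ` precritical f c \<union> PtPlus ` precritical f c"

fun hat_map :: "(real \<Rightarrow> real) \<Rightarrow> real \<Rightarrow> doubled_point \<Rightarrow> doubled_point" where
  "hat_map f c (PtMinus a) = (if a = c then Pt 1 else PtMinus (f a))"
| "hat_map f c (PtPlus a) = (if a = c then Pt 0 else PtPlus (f a))"
| "hat_map f c (Pt x) =
     (if x = 0 \<and> f 0 \<in> precritical f c then PtPlus (f 0)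
      else if x = 1 \<and> f 1 \<in> precritical f c then PtMinus (f 1)
      else Pt (f x))"

definition hat_F_set :: "(real \<Rightarrow> real) \<Rightarrow> real \<Rightarrow> nat \<Rightarrow> nat \<Rightarrow> doubled_point set" where
  "hat_F_set f c l r =
     {p \<in> doubled_space f c. forward_orbit (hat_map f c) p \<inter>
        {q \<in> doubled_space f c. doubled_less ((hat_map f c ^^ r) (PtPlus c)) q \<and>
                               doubled_less q ((hat_map f c ^^ l) (PtMinus c))} \<noteq> {}}"

end

theory Submission
  imports Defs
begin

text \<open>
  The cycle cuts $[0,1]$ into $n$ gaps, where $[0,z_0]$ and $[z_{n-1},1]$ together count as one gap,
  and \<open>f\<close> maps the \<open>j\<close>-th gap into the $(j+k)$-th one: this is what primarity says for the gap
  containing 0 and 1. Hence $f^n$ is continuous and expanding on both halves of the critical gap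
  $[a,b] = [z_{n-k-1}, z_{n-k}]$, and since it fixes $a$ and $b$, expansion yields
  $a \le u < c < v \le b$ and the Lorenz property of \<open>g\<close>. The same rotation of the gaps shows that
  $n$ divides every return time from $(a,b)$ to itself.

  For another renormalization $(f^l,f^r)$ on $[p,q]$ this gives
  $q \le b \Rightarrow n \mid l \Rightarrow a \le p \Rightarrow n \mid r \Rightarrow q \le b$, the second
  and fourth implication because an expanding map which fixes $a$ or $b$ cannot keep an interval
  around that point invariant. So it suffices to derive one of the four conditions from $l \ge n$.
  If $p < a$ and $n \nmid l$, some point of $(a,c)$ reaches $c$ after a multiple of $n$ steps and is
  a discontinuity of $f^l$, although $f^l$ is continuous on $(p,c)$.

  If $z_{k-1} = f(0)$, then $c_+$ lies in \<open>F\<close>-hat while its image under the $n$-th iterate is the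
  cycle point $a$, which does not. Otherwise $a < u$, points of $[u,v]$ return to $(u,v)$, and all points of
  $(a,c)$ are pushed away from $a$ into $(u,v)$. The statements to the right of \<open>c\<close> follow from
  those to the left by the reflection $x \mapsto 1 - x$.
\<close>

section \<open>Lorenz maps on an interval\<close>

text \<open>The notion on an arbitrary interval, without conjugation to \<open>{0..1}\<close>.
  Expansion is a lower bound of two-sided derivatives at interior points off a finite set, a form
  that passes to iterates and to restrictions.\<close>

definition lorenz_on :: "real \<Rightarrow> real \<Rightarrow> (real \<Rightarrow> real) \<Rightarrow> real \<Rightarrow> bool" where
  "lorenz_on u v g c \<longleftrightarrow>
     g ` {u..v} \<subseteq> {u..v} \<and> c \<in> {u<..<v} \<and>
     continuous_on {u..<c} g \<and> strict_mono_on {u..<c} g \<and>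
     continuous_on {c<..v} g \<and> strict_mono_on {c<..v} g \<and>
     (g \<longlongrightarrow> v) (at_left c) \<and> (g \<longlongrightarrow> u) (at_right c) \<and>
     (\<exists>F \<mu>. finite F \<and> \<mu> > 1 \<and>
        (\<forall>x\<in>{u<..<v} - F. \<exists>D\<ge>\<mu>. (g has_real_derivative D) (at x))) \<and>
     g c \<in> {u, v}"

text \<open>Both directions of the equivalence with \<open>expanding_lorenz_map_on\<close> are
  instances, one for the scaling of \<open>{0..1}\<close> onto \<open>{u..v}\<close> and one for its
  inverse.\<close>

lemma lorenz_on_affine:
  fixes p m :: real
  assumes g: "lorenz_on u v g c" and m: "m > 0"
  shows "lorenz_on (p + m * u) (p + m * v) (\<lambda>t. p + m * g ((t - p) / m)) (p + m * c)"
proof -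
  define s where "s t = (t - p) / m" for t
  have s_strict: "s x < s y" if "x < y" for x y
    using that m by (simp add: s_def divide_strict_right_mono)
  have s_lt: "s t < x \<longleftrightarrow> t < p + m * x" "x < s t \<longleftrightarrow> p + m * x < t"
    and s_le: "s t \<le> x \<longleftrightarrow> t \<le> p + m * x" "x \<le> s t \<longleftrightarrow> p + m * x \<le> t" for t x
    using m by (auto simp: s_def field_simps)
  have s_c: "s (p + m * x) = x" for x
    using m by (simp add: s_def)
  have cont_s: "continuous_on A s" for A
    using m unfolding s_def by (intro continuous_intros) auto
  have s_tendsto: "(s \<longlongrightarrow> c) (at (p + m * c) within A)" for A
    using cont_s[of UNIV] m s_c[of c]
    by (metis UNIV_I continuous_on_def tendsto_within_subset top_greatest)
  have s_neq: "s t \<noteq> c" if "t \<noteq> p + m * c" for t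
    using that s_strict[of t "p + m * c"] s_strict[of "p + m * c" t] s_c[of c] by linarith
  have s_left: "filterlim s (at_left c) (at_left (p + m * c))"
    using s_tendsto s_neq unfolding filterlim_at eventually_at_filter
    by (auto simp: s_lt intro!: always_eventually)
  have s_right: "filterlim s (at_right c) (at_right (p + m * c))"
    using s_tendsto s_neq unfolding filterlim_at eventually_at_filter
    by (auto simp: s_lt intro!: always_eventually)
  obtain F \<mu> where F: "finite F" "\<mu> > 1"
      "\<And>x. x \<in> {u<..<v} - F \<Longrightarrow> \<exists>D\<ge>\<mu>. (g has_real_derivative D) (at x)"
    using g unfolding lorenz_on_def by blast
  have "finite ((\<lambda>x. p + m * x) ` F)" using F by simp
  moreover have "\<exists>D\<ge>\<mu>. ((\<lambda>t. p + m * g (s t)) has_real_derivative D) (at t)"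
    if t: "t \<in> {p + m * u<..<p + m * v} - (\<lambda>x. p + m * x) ` F" for t
  proof -
    have "t = p + m * s t" using m by (simp add: s_def)
    then have "s t \<in> {u<..<v} - F" using t by (auto simp: s_lt)
    then obtain D where D: "D \<ge> \<mu>" "(g has_real_derivative D) (at (s t))" using F(3) by blast
    have ds: "(s has_real_derivative 1 / m) (at t)"
      unfolding s_def using m by (auto intro!: derivative_eq_intros)
    have "((\<lambda>t. p + m * g (s t)) has_real_derivative m * (D * (1 / m))) (at t)"
      using DERIV_chain2[OF D(2) ds] by (auto intro!: derivative_eq_intros)
    then show ?thesis using D(1) m by auto
  qed
  ultimately have deriv: "\<exists>F \<mu>. finite F \<and> \<mu> > 1 \<and> (\<forall>x\<in>{p + m * u<..<p + m * v} - F.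
      \<exists>D\<ge>\<mu>. ((\<lambda>t. p + m * g (s t)) has_real_derivative D) (at x))"
    using F(2) by blast
  have g': "g ` {u..v} \<subseteq> {u..v}" "u < c" "c < v" "continuous_on {u..<c} g" "continuous_on {c<..v} g"
      "strict_mono_on {u..<c} g" "strict_mono_on {c<..v} g"
      "(g \<longlongrightarrow> v) (at_left c)" "(g \<longlongrightarrow> u) (at_right c)" "g c = u \<or> g c = v"
    using g by (simp_all add: lorenz_on_def)
  have "continuous_on {p + m * u..<p + m * c} (\<lambda>t. p + m * g (s t))"
    by (intro continuous_intros continuous_on_compose2[OF g'(4) cont_s]) (auto simp: s_lt s_le)
  moreover have "continuous_on {p + m * c<..p + m * v} (\<lambda>t. p + m * g (s t))"
    by (intro continuous_intros continuous_on_compose2[OF g'(5) cont_s]) (auto simp: s_lt s_le)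
  moreover have "strict_mono_on {p + m * u..<p + m * c} (\<lambda>t. p + m * g (s t))"
    by (intro strict_mono_onI add_strict_left_mono mult_strict_left_mono m strict_mono_onD[OF g'(6)] s_strict)
      (auto simp: s_lt s_le)
  moreover have "strict_mono_on {p + m * c<..p + m * v} (\<lambda>t. p + m * g (s t))"
    by (intro strict_mono_onI add_strict_left_mono mult_strict_left_mono m strict_mono_onD[OF g'(7)] s_strict)
      (auto simp: s_lt s_le)
  moreover have "((\<lambda>t. p + m * g (s t)) \<longlongrightarrow> p + m * v) (at_left (p + m * c))"
    by (intro tendsto_intros filterlim_compose[OF g'(8) s_left])
  moreover have "((\<lambda>t. p + m * g (s t)) \<longlongrightarrow> p + m * u) (at_right (p + m * c))"
    by (intro tendsto_intros filterlim_compose[OF g'(9) s_right])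
  moreover have "(\<lambda>t. p + m * g (s t)) ` {p + m * u..p + m * v} \<subseteq> {p + m * u..p + m * v}"
  proof -
    have "g (s t) \<in> {u..v}" if "t \<in> {p + m * u..p + m * v}" for t
      using g'(1) that by (simp add: s_le image_subset_iff)
    then show ?thesis using m by auto
  qed
  moreover have "p + m * g (s (p + m * c)) \<in> {p + m * u, p + m * v}"
    using g'(10) by (auto simp: s_c)
  moreover have "p + m * c \<in> {p + m * u<..<p + m * v}"
    using m g'(2,3) by simp
  ultimately show ?thesis
    using deriv unfolding lorenz_on_def s_def[symmetric] by blast
qed

text \<open>Extracting a pointwise bound from the infimum requires the derivatives to be bounded
  below; they are nonnegative wherever a branch is monotone around the point. Conversely, the end
  points are moved into the exceptional set.\<close>

lemma expanding_lorenz_map_iff_lorenz_on: "expanding_lorenz_map f c \<longleftrightarrow> lorenz_on 0 1 f c"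
proof
  assume f: "expanding_lorenz_map f c"
  then obtain F f' where F: "finite F" "F \<subseteq> {0..1}"
      "\<And>x. x \<in> {0..1} - F \<Longrightarrow> (f has_real_derivative f' x) (at x within {0..1})"
      "(INF x\<in>{0..1} - F. f' x) > 1"
    unfolding expanding_lorenz_map_def by blast
  have interior: "(f has_real_derivative f' x) (at x)" if "x \<in> {0<..<1} - F" for x
    using F(3)[of x] that at_within_interior[of x "{0..1}"] by auto
  have nonneg: "f' x \<ge> 0" if x: "x \<in> {0<..<1} - (F \<union> {c})" for x
  proof -
    have "\<exists>A. mono_on A f \<and> x \<in> interior A"
    proof (cases "x < c")
      case True
      have "{0<..<c} \<subseteq> interior {0..<c}" by (rule interior_maximal) auto
      then show ?thesis
        using True x f unfolding expanding_lorenz_map_def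
        by (intro exI[of _ "{0..<c}"]) (auto intro: strict_mono_on_imp_mono_on)
    next
      case False
      have "{c<..<1} \<subseteq> interior {c<..1}" by (rule interior_maximal) auto
      then show ?thesis
        using False x f unfolding expanding_lorenz_map_def
        by (intro exI[of _ "{c<..1}"]) (auto intro: strict_mono_on_imp_mono_on)
    qed
    then show ?thesis using interior[of x] x mono_on_imp_deriv_nonneg by blast
  qed
  have "bdd_below (f' ` ({0<..<1} - (F \<union> {c})))"
    using nonneg by (intro bdd_belowI2[of _ 0]) blast
  \<comment> \<open>Adding the three points that monotonicity leaves open changes the set of values
    only by finitely many.\<close>
  then have "bdd_below (f' ` (({0<..<1} - (F \<union> {c})) \<union> {0, 1, c}))"
    unfolding image_Un by simp
  then have bdd: "bdd_below (f' ` ({0..1} - F))"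
    by (rule bdd_below_mono) (intro image_mono, auto simp: less_le)
  have "f' x \<ge> (INF x\<in>{0..1} - F. f' x)" if "x \<in> {0<..<1} - F" for x
    using that by (intro cINF_lower bdd) auto
  then have "\<exists>F \<mu>. finite F \<and> \<mu> > 1 \<and>
      (\<forall>x\<in>{0<..<1} - F. \<exists>D\<ge>\<mu>. (f has_real_derivative D) (at x))"
    using F(1,4) interior by blast
  then show "lorenz_on 0 1 f c"
    using f unfolding expanding_lorenz_map_def lorenz_on_def by blast
next
  assume f: "lorenz_on 0 1 f c"
  then obtain F \<mu> where F: "finite F" "\<mu> > 1"
      "\<And>x. x \<in> {0<..<1} - F \<Longrightarrow> \<exists>D\<ge>\<mu>. (f has_real_derivative D) (at x)"
    unfolding lorenz_on_def by blast
  then obtain f' where f': "\<And>x. x \<in> {0<..<1} - F \<Longrightarrow> f' x \<ge> \<mu> \<and> (f has_real_derivative f' x) (at x)"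
    by metis
  define F0 where "F0 = F \<inter> {0..1} \<union> {0, 1}"
  have F0: "finite F0" "F0 \<subseteq> {0..1}" "{0..1} - F0 \<subseteq> {0<..<1} - F"
    using F(1) by (auto simp: F0_def less_le)
  have "infinite ({0..1::real} - F0)"
    using F0(1) by (simp add: infinite_Icc)
  then have "{0..1} - F0 \<noteq> {}" by force
  then have "(INF x\<in>{0..1} - F0. f' x) \<ge> \<mu>"
    using F0(3) f' by (intro cINF_greatest) blast+
  moreover have "(f has_real_derivative f' x) (at x within {0..1})" if "x \<in> {0..1} - F0" for x
    using f'[of x] that F0(3) has_field_derivative_at_within by blast
  ultimately have "\<exists>F f'. finite F \<and> F \<subseteq> {0..1} \<and>
        (\<forall>x\<in>{0..1} - F. (f has_real_derivative f' x) (at x within {0..1})) \<and>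
        (INF x\<in>{0..1} - F. f' x) > 1"
    using F0(1,2) F(2) by (intro exI[of _ F0] exI[of _ f']) auto
  then show "expanding_lorenz_map f c"
    using f unfolding expanding_lorenz_map_def lorenz_on_def by blast
qed

lemma expanding_lorenz_map_on_iff_lorenz_on: "expanding_lorenz_map_on u v g c \<longleftrightarrow> lorenz_on u v g c"
proof
  assume g: "expanding_lorenz_map_on u v g c"
  define h where "h t = (g (u + (v - u) * t) - u) / (v - u)" for t
  have uv: "v - u > 0" and h: "lorenz_on 0 1 h ((c - u) / (v - u))"
    using g unfolding expanding_lorenz_map_on_def expanding_lorenz_map_iff_lorenz_on h_def by auto
  have "(\<lambda>t. u + (v - u) * h ((t - u) / (v - u))) = g"
    using uv by (auto simp: h_def)
  then show "lorenz_on u v g c"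
    using lorenz_on_affine[OF h uv, of u] uv by simp
next
  assume g: "lorenz_on u v g c"
  then have uv: "v - u > 0" by (auto simp: lorenz_on_def)
  define m where "m = 1 / (v - u)"
  define p where "p = - u / (v - u)"
  have m: "m > 0" using uv by (simp add: m_def)
  have "p + m * x = (x - u) / (v - u)" for x
    by (simp add: p_def m_def diff_divide_distrib)
  moreover have "(t - p) / m = u + (v - u) * t" for t
    using uv by (simp add: p_def m_def field_simps)
  ultimately have "lorenz_on 0 1 (\<lambda>t. (g (u + (v - u) * t) - u) / (v - u)) ((c - u) / (v - u))"
    using lorenz_on_affine[OF g m, of p] uv by simp
  then show "expanding_lorenz_map_on u v g c"
    using uv unfolding expanding_lorenz_map_on_def expanding_lorenz_map_iff_lorenz_on by simp
qed

text \<open>Without exceptional points inside, \<open>g t - \<mu> * t\<close> is nondecreasing by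
  the sign of its derivative. Otherwise the interval is cut at an exceptional point, and the
  estimates on the two pieces, each with fewer exceptions, add up.\<close>

lemma expanding_if_deriv_ge_except_finite:
  fixes g :: "real \<Rightarrow> real"
  assumes "finite F" "x \<le> y" "continuous_on {x..y} g"
    and "\<And>t. t \<in> {x<..<y} - F \<Longrightarrow> \<exists>D\<ge>\<mu>. (g has_real_derivative D) (at t)"
  shows "\<mu> * (y - x) \<le> g y - g x"
  using assms
proof (induction F arbitrary: x y rule: finite_psubset_induct)
  case (psubset F)
  show ?case
  proof (cases "F \<inter> {x<..<y} = {}")
    case True
    have "\<exists>D\<ge>0. ((\<lambda>t. g t - \<mu> * t) has_real_derivative D) (at t)" if "x < t" "t < y" for t
    proof -
      have "t \<in> {x<..<y} - F" using that True by auto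
      then obtain D where "D \<ge> \<mu>" "(g has_real_derivative D) (at t)"
        using psubset.prems(3) by blast
      then show ?thesis
        by (intro exI[of _ "D - \<mu>"]) (auto intro!: derivative_eq_intros)
    qed
    moreover have "continuous_on {x..y} (\<lambda>t. g t - \<mu> * t)"
      using psubset.prems(2) by (intro continuous_intros)
    ultimately have "g x - \<mu> * x \<le> g y - \<mu> * y"
      using DERIV_nonneg_imp_increasing_open[OF psubset.prems(1), of "\<lambda>t. g t - \<mu> * t"] by blast
    then show ?thesis by (simp add: algebra_simps)
  next
    case False
    then obtain q where q: "q \<in> F" "x < q" "q < y" by auto
    have *: "F - {q} \<subset> F" using q by auto
    have "\<mu> * (q - x) \<le> g q - g x"
      using q psubset.prems by (intro psubset.IH[OF *]) (auto intro: continuous_on_subset)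
    moreover have "\<mu> * (y - q) \<le> g y - g q"
      using q psubset.prems by (intro psubset.IH[OF *]) (auto intro: continuous_on_subset)
    ultimately show ?thesis by (simp add: algebra_simps)
  qed
qed

lemma lorenz_on_expanding:
  assumes "lorenz_on u v g c"
  obtains \<mu> where "\<mu> > 1"
    "\<And>x y. u \<le> x \<Longrightarrow> x \<le> y \<Longrightarrow> y < c \<Longrightarrow> \<mu> * (y - x) \<le> g y - g x"
    "\<And>x y. c < x \<Longrightarrow> x \<le> y \<Longrightarrow> y \<le> v \<Longrightarrow> \<mu> * (y - x) \<le> g y - g x"
proof -
  obtain F \<mu> where F: "finite F" "\<mu> > 1"
      "\<And>x. x \<in> {u<..<v} - F \<Longrightarrow> \<exists>D\<ge>\<mu>. (g has_real_derivative D) (at x)"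
    and g: "continuous_on {u..<c} g" "continuous_on {c<..v} g" "u < c" "c < v"
    using assms unfolding lorenz_on_def by auto
  show thesis
  proof (rule that)
    show "\<mu> > 1" by fact
    show "\<mu> * (y - x) \<le> g y - g x" if "u \<le> x" "x \<le> y" "y < c" for x y
      using F g that
      by (intro expanding_if_deriv_ge_except_finite[OF F(1)]) (auto intro: continuous_on_subset)
    show "\<mu> * (y - x) \<le> g y - g x" if "c < x" "x \<le> y" "y \<le> v" for x y
      using F g that
      by (intro expanding_if_deriv_ge_except_finite[OF F(1)]) (auto intro: continuous_on_subset)
  qed
qed

lemma lorenz_on_funpow_range:
  assumes "lorenz_on u v g c" and x: "x \<in> {u..v}"
  shows "(g ^^ i) x \<in> {u..v}"
proof -
  have g: "g y \<in> {u..v}" if "y \<in> {u..v}" for y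
    using assms(1) that by (auto simp: lorenz_on_def image_subset_iff)
  show ?thesis
  proof (induction i)
    case 0
    then show ?case using x by simp
  next
    case (Suc i)
    then show ?case using g by (simp del: atLeastAtMost_iff)
  qed
qed

section \<open>Preimages and derivatives under iterates\<close>

lemma lorenz_on_finite_vimage_funpow:
  assumes f: "lorenz_on 0 1 f c" and S: "finite S"
  shows "finite {x \<in> {0..1}. (f ^^ i) x \<in> S}"
  using S
proof (induction i arbitrary: S)
  case 0
  then show ?case by simp
next
  case (Suc i)
  have "inj_on f {0..<c}" "inj_on f {c<..1}"
    using f by (auto simp: lorenz_on_def intro: strict_mono_on_imp_inj_on)
  \<comment> \<open>Each branch is injective, and \<open>c\<close> is added because neither branch
    contains it.\<close>
  then have fin: "finite (f -` S \<inter> {0..<c} \<union> f -` S \<inter> {c<..1} \<union> {c})"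
    using Suc.prems finite_vimage_IntI by blast
  have range: "(f ^^ i) x \<in> {0..1}" if "x \<in> {0..1}" for x
    using lorenz_on_funpow_range[OF f that] .
  have "{x \<in> {0..1}. (f ^^ Suc i) x \<in> S} \<subseteq>
      {x \<in> {0..1}. (f ^^ i) x \<in> f -` S \<inter> {0..<c} \<union> f -` S \<inter> {c<..1} \<union> {c}}"
    using range by fastforce
  then show ?case using Suc.IH[OF fin] finite_subset by blast
qed

lemma lorenz_on_deriv_funpow:
  assumes f: "lorenz_on 0 1 f c"
  obtains F \<mu> where "finite F" "\<mu> > 1"
    "\<And>x. x \<in> {0<..<1} - F \<Longrightarrow> \<exists>D\<ge>\<mu> ^ i. ((f ^^ i) has_real_derivative D) (at x)"
proof -
  obtain F \<mu> where F: "finite F" "\<mu> > 1"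
      "\<And>x. x \<in> {0<..<1} - F \<Longrightarrow> \<exists>D\<ge>\<mu>. (f has_real_derivative D) (at x)"
    using f unfolding lorenz_on_def by blast
  have range: "(f ^^ i) x \<in> {0..1}" if "x \<in> {0..1}" for x i
    using lorenz_on_funpow_range[OF f that] .
  have "\<exists>G. finite G \<and>
      (\<forall>x\<in>{0<..<1} - G. \<exists>D\<ge>\<mu> ^ i. ((f ^^ i) has_real_derivative D) (at x))"
  proof (induction i)
    case 0
    have "((f ^^ 0) has_real_derivative 1) (at x)" for x
      by (simp add: id_def)
    then show ?case by (metis finite.emptyI order_refl power_0)
  next
    case (Suc i)
    then obtain G where G: "finite G"
        "\<And>x. x \<in> {0<..<1} - G \<Longrightarrow> \<exists>D\<ge>\<mu> ^ i. ((f ^^ i) has_real_derivative D) (at x)"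
      by blast
    \<comment> \<open>Points mapped to 0 or 1 are excluded too, since the derivative of
      \<open>f\<close> is controlled only in the open interval.\<close>
    define G' where "G' = G \<union> {x \<in> {0..1}. (f ^^ i) x \<in> F \<union> {0, 1}}"
    have "\<exists>D\<ge>\<mu> ^ Suc i. ((f ^^ Suc i) has_real_derivative D) (at x)"
      if x: "x \<in> {0<..<1} - G'" for x
    proof -
      have "(f ^^ i) x \<in> {0<..<1} - F"
        using x range[of x i] by (auto simp: G'_def less_le)
      then obtain D where D: "D \<ge> \<mu>" "(f has_real_derivative D) (at ((f ^^ i) x))"
        using F(3) by blast
      obtain E where E: "E \<ge> \<mu> ^ i" "((f ^^ i) has_real_derivative E) (at x)"
        using G(2)[of x] x by (auto simp: G'_def)
      have "((f ^^ Suc i) has_real_derivative D * E) (at x)"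
        using DERIV_chain2[OF D(2) E(2)] by (simp add: o_def)
      moreover have "D * E \<ge> \<mu> ^ Suc i"
        using D(1) E(1) F(2) by (auto intro!: mult_mono)
      ultimately show ?thesis by blast
    qed
    moreover have "finite G'"
      using G(1) F(1) lorenz_on_finite_vimage_funpow[OF f, of "F \<union> {0, 1}" i] by (simp add: G'_def)
    ultimately show ?case by blast
  qed
  then show thesis using that F(2) by blast
qed

text \<open>The consequences of \<open>lorenz_on 0 1 f c\<close> used from here on. The derivative
  is replaced by a uniform expansion inequality on each branch, so that \<open>\<mu>\<close> is a
  fixed constant shared with the reflected map.\<close>

locale lorenz =
  fixes f :: "real \<Rightarrow> real" and c \<mu> :: real
  assumes range: "x \<in> {0..1} \<Longrightarrow> f x \<in> {0..1}"
    and c: "0 < c" "c < 1"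
    and continuous: "continuous_on {0..<c} f" "continuous_on {c<..1} f"
    and tendsto: "(f \<longlongrightarrow> 1) (at_left c)" "(f \<longlongrightarrow> 0) (at_right c)"
    and \<mu>: "\<mu> > 1"
    and expand_left: "0 \<le> x \<Longrightarrow> x \<le> y \<Longrightarrow> y < c \<Longrightarrow> \<mu> * (y - x) \<le> f y - f x"
    and expand_right: "c < x \<Longrightarrow> x \<le> y \<Longrightarrow> y \<le> 1 \<Longrightarrow> \<mu> * (y - x) \<le> f y - f x"
    and f_c: "f c \<in> {0, 1}"
begin

lemma mono_branches:
  "0 \<le> x \<Longrightarrow> x \<le> y \<Longrightarrow> y < c \<Longrightarrow> f x \<le> f y"
  "c < x \<Longrightarrow> x \<le> y \<Longrightarrow> y \<le> 1 \<Longrightarrow> f x \<le> f y"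
  using expand_left[of x y] expand_right[of x y] \<mu>
  by (smt (verit) mult_nonneg_nonneg)+

text \<open>While the images of \<open>S\<close> stay within single branches, the iterate is a
  composition of continuous maps that expand by \<open>\<mu>\<close>, and the factors
  multiply.\<close>

lemma funpow_branches:
  assumes "S \<subseteq> {0..1}"
    and "\<And>j. j < i \<Longrightarrow> (f ^^ j) ` S \<subseteq> {0..<c} \<or> (f ^^ j) ` S \<subseteq> {c<..1}"
  shows "continuous_on S (f ^^ i)"
    and "x \<in> S \<Longrightarrow> y \<in> S \<Longrightarrow> x \<le> y \<Longrightarrow> \<mu> ^ i * (y - x) \<le> (f ^^ i) y - (f ^^ i) x"
proof -
  have "continuous_on S (f ^^ i) \<and> (\<forall>x\<in>S. \<forall>y\<in>S. x \<le> y \<longrightarrow>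
      \<mu> ^ i * (y - x) \<le> (f ^^ i) y - (f ^^ i) x)"
    using assms(2)
  proof (induction i)
    case 0
    then show ?case by (simp add: id_def)
  next
    case (Suc i)
    then have IH: "continuous_on S (f ^^ i)"
        "\<And>x y. x \<in> S \<Longrightarrow> y \<in> S \<Longrightarrow> x \<le> y \<Longrightarrow> \<mu> ^ i * (y - x) \<le> (f ^^ i) y - (f ^^ i) x"
      by auto
    have branch: "(f ^^ i) ` S \<subseteq> {0..<c} \<or> (f ^^ i) ` S \<subseteq> {c<..1}"
      using Suc.prems by blast
    then have "continuous_on ((f ^^ i) ` S) f"
      using continuous continuous_on_subset by blast
    then have "continuous_on S (f ^^ Suc i)"
      using continuous_on_compose[OF IH(1)] by simp
    moreover have "\<mu> ^ Suc i * (y - x) \<le> (f ^^ Suc i) y - (f ^^ Suc i) x"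
      if "x \<in> S" "y \<in> S" "x \<le> y" for x y
    proof -
      have *: "\<mu> ^ i * (y - x) \<le> (f ^^ i) y - (f ^^ i) x" by (rule IH(2)[OF that])
      moreover have "0 \<le> \<mu> ^ i * (y - x)" using \<mu> that by simp
      ultimately have "(f ^^ i) x \<le> (f ^^ i) y" by linarith
      moreover have "(f ^^ i) x \<in> {0..<c} \<and> (f ^^ i) y \<in> {0..<c} \<or>
          (f ^^ i) x \<in> {c<..1} \<and> (f ^^ i) y \<in> {c<..1}"
        using branch that(1,2) by blast
      ultimately have "\<mu> * ((f ^^ i) y - (f ^^ i) x) \<le> f ((f ^^ i) y) - f ((f ^^ i) x)"
        using expand_left expand_right by auto
      moreover have "\<mu> * (\<mu> ^ i * (y - x)) \<le> \<mu> * ((f ^^ i) y - (f ^^ i) x)"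
        using * \<mu> by (intro mult_left_mono) auto
      ultimately show ?thesis by (simp add: mult.assoc)
    qed
    ultimately show ?case by blast
  qed
  then show "continuous_on S (f ^^ i)"
    and "x \<in> S \<Longrightarrow> y \<in> S \<Longrightarrow> x \<le> y \<Longrightarrow> \<mu> ^ i * (y - x) \<le> (f ^^ i) y - (f ^^ i) x"
    by blast+
qed

end

lemma lorenz_if_lorenz_on:
  assumes f: "lorenz_on 0 1 f c"
  obtains \<mu> where "lorenz f c \<mu>"
proof -
  obtain \<mu> where "\<mu> > 1"
      "\<And>x y. 0 \<le> x \<Longrightarrow> x \<le> y \<Longrightarrow> y < c \<Longrightarrow> \<mu> * (y - x) \<le> f y - f x"
      "\<And>x y. c < x \<Longrightarrow> x \<le> y \<Longrightarrow> y \<le> 1 \<Longrightarrow> \<mu> * (y - x) \<le> f y - f x"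
    using lorenz_on_expanding[OF f] by blast
  moreover have "f x \<in> {0..1}" if "x \<in> {0..1}" for x
    using lorenz_on_funpow_range[OF f that, of 1] by simp
  ultimately have "lorenz f c \<mu>"
    using f unfolding lorenz_on_def by unfold_locales simp_all
  then show thesis by (rule that)
qed

section \<open>Reflection\<close>

text \<open>The conjugate of \<open>f\<close> by the involution of \<open>[0,1]\<close> that
  reverses order. It exchanges the two branches.\<close>

definition reflect :: "(real \<Rightarrow> real) \<Rightarrow> real \<Rightarrow> real" where
  "reflect f x = 1 - f (1 - x)"

lemma reflect_reflect [simp]: "reflect (reflect h) = h"
  by (simp add: reflect_def fun_eq_iff)

lemma funpow_reflect: "reflect f ^^ i = reflect (f ^^ i)"
  by (induction i) (auto simp: reflect_def fun_eq_iff)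

lemma filterlim_one_minus:
  "filterlim (\<lambda>x::real. 1 - x) (at_right a) (at_left (1 - a))"
  "filterlim (\<lambda>x::real. 1 - x) (at_left a) (at_right (1 - a))"
proof -
  have *: "((\<lambda>x. 1 - x) \<longlongrightarrow> a) (at (1 - a) within A)" for A
    by (auto intro!: tendsto_eq_intros)
  show "filterlim (\<lambda>x::real. 1 - x) (at_right a) (at_left (1 - a))"
    "filterlim (\<lambda>x::real. 1 - x) (at_left a) (at_right (1 - a))"
    using * by (auto simp: filterlim_at eventually_at_filter intro!: always_eventually)
qed

lemma tendsto_reflect:
  "(h \<longlongrightarrow> l) (at_right a) \<Longrightarrow> (reflect h \<longlongrightarrow> 1 - l) (at_left (1 - a))"
  "(h \<longlongrightarrow> l) (at_left a) \<Longrightarrow> (reflect h \<longlongrightarrow> 1 - l) (at_right (1 - a))"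
  using filterlim_compose[OF _ filterlim_one_minus(1)] filterlim_compose[OF _ filterlim_one_minus(2)]
  unfolding reflect_def by (auto intro!: tendsto_intros)

lemma continuous_on_reflect:
  assumes "continuous_on T h" "\<And>x. x \<in> S \<Longrightarrow> 1 - x \<in> T"
  shows "continuous_on S (reflect h)"
  unfolding reflect_def using assms by (intro continuous_intros continuous_on_compose2[OF assms(1)]) auto

lemma (in lorenz) lorenz_reflect: "lorenz (reflect f) (1 - c) \<mu>"
proof
  show "continuous_on {0..<1 - c} (reflect f)"
    by (rule continuous_on_reflect[OF continuous(2)]) auto
  show "continuous_on {1 - c<..1} (reflect f)"
    by (rule continuous_on_reflect[OF continuous(1)]) auto
  show "(reflect f \<longlongrightarrow> 1) (at_left (1 - c))" "(reflect f \<longlongrightarrow> 0) (at_right (1 - c))"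
    using tendsto_reflect(1)[OF tendsto(2)] tendsto_reflect(2)[OF tendsto(1)] by simp_all
  show "\<mu> * (y - x) \<le> reflect f y - reflect f x" if "0 \<le> x" "x \<le> y" "y < 1 - c" for x y
    using expand_right[of "1 - y" "1 - x"] that by (simp add: reflect_def)
  show "\<mu> * (y - x) \<le> reflect f y - reflect f x" if "1 - c < x" "x \<le> y" "y \<le> 1" for x y
    using expand_left[of "1 - y" "1 - x"] that by (simp add: reflect_def)
  show "reflect f x \<in> {0..1}" if "x \<in> {0..1}" for x
    using range[of "1 - x"] that by (simp add: reflect_def)
  show "reflect f (1 - c) \<in> {0, 1}"
    using f_c by (auto simp: reflect_def)
qed (use c \<mu> in auto)

section \<open>The gaps of a primary cycle\<close>

locale primary_cycle = lorenz +
  fixes n k :: nat and z :: "nat \<Rightarrow> real"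
  assumes primary: "primary_nk_cycle f c n k z"
begin

abbreviation a :: real where "a \<equiv> z (n - k - 1)"
abbreviation b :: real where "b \<equiv> z (n - k)"
abbreviation u :: real where "u \<equiv> (f ^^ (n - 1)) 0"
abbreviation v :: real where "v \<equiv> (f ^^ (n - 1)) 1"

lemma k: "1 \<le> k" "k < n" "coprime k n"
  and z_range: "j < n \<Longrightarrow> 0 \<le> z j" "j < n \<Longrightarrow> z j \<le> 1"
  and z_less: "i < j \<Longrightarrow> j < n \<Longrightarrow> z i < z j"
  and c_between: "a < c" "c < b"
  and f_z: "j < n \<Longrightarrow> f (z j) = z ((j + k) mod n)"
  and f_ends: "z (k - 1) \<le> f 0" "f 1 \<le> z k"
  using primary unfolding primary_nk_cycle_def nk_cycle_def
  by (auto simp: strict_mono_on_def)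

lemma z_le: "i \<le> j \<Longrightarrow> j < n \<Longrightarrow> z i \<le> z j"
  using z_less[of i j] by (cases "i = j") auto

lemma z_left: "j < n - k \<Longrightarrow> z j < c"
  using z_le[of j "n - k - 1"] c_between k by fastforce

lemma z_right: "n - k \<le> j \<Longrightarrow> j < n \<Longrightarrow> c < z j"
  using z_le[of "n - k" j] c_between k by fastforce

lemma f_z_left: "j < n - k \<Longrightarrow> f (z j) = z (j + k)"
  using f_z[of j] by simp

lemma f_z_right: "n - k \<le> j \<Longrightarrow> j < n \<Longrightarrow> f (z j) = z (j + k - n)"
  using f_z[of j] k by (auto simp: mod_if)

lemma funpow_z: "j < n \<Longrightarrow> (f ^^ i) (z j) = z ((j + i * k) mod n)"
proof (induction i)
  case (Suc i)
  then show ?case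
    using f_z[of "(j + i * k) mod n"] by (simp add: mod_simps algebra_simps)
qed simp

lemma funpow_n_z: "j < n \<Longrightarrow> (f ^^ (i * n)) (z j) = z j"
  by (simp add: funpow_z mult.assoc mult.left_commute[of _ n])

text \<open>Reversing the indices turns the shift by \<open>k\<close> into the shift by
  \<open>-k\<close>, which is \<open>n - k\<close> modulo \<open>n\<close>. Accordingly
  \<open>n - k\<close> points of the reflected cycle lie to the right of
  \<open>1 - c\<close>.\<close>

lemma reflect_primary: "primary_cycle (reflect f) (1 - c) \<mu> n (n - k) (\<lambda>j. 1 - z (n - 1 - j))"
proof -
  have "reflect f (1 - z (n - 1 - j)) = 1 - z (n - 1 - (j + (n - k)) mod n)" if "j < n" for j
  proof (cases "j < k")
    case True
    then have "n - 1 - j + k - n = k - 1 - j" "(j + (n - k)) mod n = j + (n - k)"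
      "n - 1 - (j + (n - k)) = k - 1 - j"
      using k that by simp_all
    then show ?thesis
      using f_z_right[of "n - 1 - j"] True that by (simp add: reflect_def)
  next
    case False
    then have "(j + (n - k)) mod n = j - k"
      using k that by (simp add: mod_if)
    moreover have "n - 1 - (j - k) = n - 1 - j + k"
      using False that by simp
    ultimately show ?thesis
      using f_z_left[of "n - 1 - j"] False that by (simp add: reflect_def)
  qed
  moreover have "coprime (n - k) n"
  proof -
    have "gcd (n - k) (n - k + k) = gcd n k"
      using k gcd_diff1_nat[of k n] by (simp only: gcd_add2 less_imp_le_nat)
    then show ?thesis
      using k by (simp add: coprime_iff_gcd_eq_1 gcd.commute)
  qed
  moreover have "strict_mono_on {..<n} (\<lambda>j. 1 - z (n - 1 - j))"
    by (intro strict_mono_onI) (auto intro!: z_less)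
  ultimately have "primary_nk_cycle (reflect f) (1 - c) n (n - k) (\<lambda>j. 1 - z (n - 1 - j))"
    using k z_range c_between f_ends unfolding primary_nk_cycle_def nk_cycle_def
    by (auto simp: reflect_def)
  then show ?thesis
    using lorenz_reflect by (simp add: primary_cycle_def primary_cycle_axioms_def)
qed

text \<open>The two outer pieces are glued into one gap because \<open>f\<close> jumps from 1 to 0
  at \<open>c\<close>, so that the critical gap is spread over both.\<close>

definition gap :: "nat \<Rightarrow> real set" where
  "gap j = (if j = 0 then {0..z 0} \<union> {z (n - 1)..1} else {z (j - 1)..z j})"

lemma gap_critical: "gap (n - k) = {a..b}"
  using k by (simp add: gap_def)

lemma ab_range: "0 \<le> a" "b \<le> 1"
  using z_range k by simp_all

lemma f_left_gap: "a \<le> x \<Longrightarrow> x < c \<Longrightarrow> z (n - 1) \<le> f x \<and> f x \<le> 1"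
  using mono_branches(1)[of a x] f_z_left[of "n - k - 1"] k ab_range c range[of x] by simp

lemma f_right_gap: "c < x \<Longrightarrow> x \<le> b \<Longrightarrow> 0 \<le> f x \<and> f x \<le> z 0"
  using mono_branches(2)[of x b] f_z_right[of "n - k"] k ab_range c range[of x] by simp

text \<open>On gaps away from \<open>c\<close> and from the ends, monotonicity squeezes
  \<open>f x\<close> between the images of the cycle points. On gap 0 the inequalities of primarity
  replace the missing outer cycle points; the critical gap is mapped to the outer pieces.\<close>

lemma f_gap:
  assumes x: "x \<in> gap j" and j: "j < n"
  shows "f x \<in> gap ((j + k) mod n)"
proof -
  consider "j = 0" "0 \<le> x" "x \<le> z 0" | "j = 0" "z (n - 1) \<le> x" "x \<le> 1" |
    "0 < j" "j < n - k" | "j = n - k" "x < c" | "x = c" | "j = n - k" "c < x" | "n - k < j"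
    using x unfolding gap_def by (cases "j = 0"; cases "x < c"; cases "x = c"; cases "j < n - k"; cases "j = n - k") auto
  then show ?thesis
  proof cases
    case 1
    then show ?thesis
      using mono_branches(1)[of 0 x] mono_branches(1)[of x "z 0"] z_left[of 0] f_z_left[of 0] k f_ends
      by (simp add: gap_def)
  next
    case 2
    moreover have "c < z (n - 1)"
      using k by (intro z_right) auto
    ultimately show ?thesis
      using mono_branches(2)[of x 1] mono_branches(2)[of "z (n - 1)" x]
        f_z_right[of "n - 1"] k f_ends
      by (simp add: gap_def)
  next
    case 3
    then have "0 \<le> z (j - 1)" "z (j - 1) \<le> x" "x \<le> z j" "z j < c"
      using x z_range z_left k j by (simp_all add: gap_def)
    moreover have "f (z (j - 1)) = z (j + k - 1)" "f (z j) = z (j + k)"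
      using f_z_left[of "j - 1"] f_z_left[of j] 3 by simp_all
    ultimately show ?thesis
      using 3 mono_branches(1)[of "z (j - 1)" x] mono_branches(1)[of x "z j"]
      by (simp add: gap_def)
  next
    case 4
    then show ?thesis using x k f_left_gap[of x] by (simp add: gap_critical) (simp add: gap_def)
  next
    case 5
    \<comment> \<open>The point \<open>c\<close> lies in no other gap, and its image, 0 or 1, lies
      in gap 0 for either choice.\<close>
    have "j = n - k"
    proof (rule ccontr)
      assume "j \<noteq> n - k"
      then consider "j = 0" | "0 < j" "j < n - k" | "n - k < j" by linarith
      then show False
      proof cases
        case 1
        moreover have "z 0 < c" "c < z (n - 1)"
          using k by (auto intro: z_left z_right)
        ultimately show ?thesis using 5 x by (simp add: gap_def)
      next
        case 2
        then show ?thesis using 5 x z_left[of j] by (simp add: gap_def)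
      next
        case 3
        then have "c < z (j - 1)"
          using j by (intro z_right) auto
        then show ?thesis using 3 5 x by (simp add: gap_def)
      qed
    qed
    then show ?thesis using 5 k f_c z_range[of 0] z_range[of "n - 1"] by (auto simp: gap_def)
  next
    case 6
    then show ?thesis using x k f_right_gap[of x] by (simp add: gap_critical) (simp add: gap_def)
  next
    case 7
    then have "c < z (j - 1)" "z (j - 1) \<le> x" "x \<le> z j" "z j \<le> 1"
      using x z_range z_right[of "j - 1"] k j by (simp_all add: gap_def)
    moreover have "f (z (j - 1)) = z (j + k - n - 1)" "f (z j) = z (j + k - n)"
      using f_z_right[of "j - 1"] f_z_right[of j] 7 j k
      by (simp_all add: Suc_diff_Suc diff_commute[of _ 1])
    moreover have "(j + k) mod n = j + k - n" "j + k - n \<noteq> 0"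
      using 7 j k by (simp_all add: mod_if)
    ultimately show ?thesis
      using mono_branches(2)[of "z (j - 1)" x] mono_branches(2)[of x "z j"]
      by (simp add: gap_def)
  qed
qed

lemma funpow_gap: "x \<in> gap j \<Longrightarrow> j < n \<Longrightarrow> (f ^^ i) x \<in> gap ((j + i * k) mod n)"
proof (induction i)
  case (Suc i)
  then show ?case
    using f_gap[of "(f ^^ i) x" "(j + i * k) mod n"] by (simp add: mod_simps algebra_simps)
qed simp

lemma gap_inter_critical:
  assumes "x \<in> gap j" "j < n" "a < x" "x < b"
  shows "j = n - k"
proof (rule ccontr)
  assume "j \<noteq> n - k"
  then consider "j = 0" | "0 < j" "j \<le> n - k - 1" | "n - k \<le> j - 1" by linarith
  then show False
  proof cases
    case 1
    have "n - k \<le> n - 1" using k by simp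
    then show ?thesis using 1 assms z_le[of 0 "n - k - 1"] z_le[of "n - k" "n - 1"] k by (auto simp: gap_def)
  next
    case 2
    then show ?thesis using assms z_le[of j "n - k - 1"] k by (simp add: gap_def)
  next
    case 3
    then have "b \<le> z (j - 1)" using assms k by (intro z_le) auto
    then show ?thesis using 3 assms k by (simp add: gap_def split: if_splits)
  qed
qed

text \<open>After \<open>i\<close> steps the gap index has moved by \<open>i * k\<close>, and the
  open critical gap meets no other gap. Hence \<open>n\<close> divides \<open>i * k\<close>, and
  coprimality removes \<open>k\<close>.\<close>

lemma return_to_critical_gap:
  assumes "a < x" "x < b" "a < (f ^^ i) x" "(f ^^ i) x < b"
  shows "n dvd i"
proof -
  have "(f ^^ i) x \<in> gap ((n - k + i * k) mod n)"
    using assms k by (intro funpow_gap) (auto simp: gap_critical)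
  then have "(n - k + i * k) mod n = n - k"
    using gap_inter_critical assms k by simp
  then have "(i * k + (n - k)) mod n = (n - k) mod n"
    using k by (simp add: add.commute)
  then have "n dvd i * k"
    using mod_eq_dvd_iff_nat[of "n - k" "i * k + (n - k)" n] by simp
  then show ?thesis
    using k by (simp add: coprime_commute coprime_dvd_mult_left_iff)
qed

subsection \<open>The return map of the critical gap\<close>

lemma z_last: "c < z (n - 1)"
  using k by (intro z_right) auto

lemma gap_branch:
  assumes "j < n" "j \<noteq> 0" "j \<noteq> n - k"
  shows "gap j \<subseteq> {0..<c} \<or> gap j \<subseteq> {c<..1}"
proof (cases "j < n - k")
  case True
  then have "0 \<le> z (j - 1)" "z j < c" using assms by (auto intro: z_range z_left)
  then show ?thesis using assms by (auto simp: gap_def)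
next
  case False
  then have "c < z (j - 1)" "z j \<le> 1" using assms by (auto intro!: z_range z_right)
  then show ?thesis using assms by (auto simp: gap_def)
qed

text \<open>Index 0 would make \<open>n\<close> divide \<open>i * k\<close>, index
  \<open>n - k\<close> would make it divide \<open>Suc i * k\<close>. Both are impossible by
  coprimality, as \<open>0 < i\<close> and \<open>Suc i < n\<close>.\<close>

lemma orbit_gap_branch:
  assumes "1 \<le> i" "i < n - 1"
  shows "gap (i * k mod n) \<subseteq> {0..<c} \<or> gap (i * k mod n) \<subseteq> {c<..1}"
proof (rule gap_branch)
  have not_dvd: "\<not> n dvd j * k" if "0 < j" "j < n" for j
    using that k by (auto simp: coprime_commute coprime_dvd_mult_left_iff dest: dvd_imp_le)
  show "i * k mod n \<noteq> 0"
    using not_dvd[of i] assms by (simp add: mod_eq_0_iff_dvd)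
  show "i * k mod n \<noteq> n - k"
  proof
    assume "i * k mod n = n - k"
    then have "(i * k mod n + k) mod n = 0" using k by simp
    then have "n dvd Suc i * k"
      by (simp add: mod_simps mod_eq_0_iff_dvd add.commute)
    then show False
      using not_dvd[of "Suc i"] assms by linarith
  qed
qed (use k in simp)

lemma gap_0_iterates: "x \<in> gap 0 \<Longrightarrow> 1 \<le> i \<Longrightarrow> i < n - 1 \<Longrightarrow>
    (f ^^ i) x \<in> gap (i * k mod n)"
  using funpow_gap[of x 0 i] k by simp

lemma funpow_right_end_branch:
  assumes "j < n - 1"
  shows "(f ^^ j) ` {z (n - 1)..1} \<subseteq> {0..<c} \<or> (f ^^ j) ` {z (n - 1)..1} \<subseteq> {c<..1}"
proof (cases "j = 0")
  case True
  then show ?thesis using z_last by auto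
next
  case False
  then have "(f ^^ j) ` {z (n - 1)..1} \<subseteq> gap (j * k mod n)"
    using gap_0_iterates[of _ j] assms by (auto simp: gap_def[of 0])
  moreover have "gap (j * k mod n) \<subseteq> {0..<c} \<or> gap (j * k mod n) \<subseteq> {c<..1}"
    using False assms by (intro orbit_gap_branch) auto
  ultimately show ?thesis by (metis subset_trans)
qed

text \<open>One step carries \<open>{a..<c}\<close> into the upper piece of gap 0, whose iterates
  stay off \<open>c\<close> for the next \<open>n - 2\<close> steps.\<close>

lemma funpow_left_branch:
  assumes "j < n"
  shows "(f ^^ j) ` {a..<c} \<subseteq> {0..<c} \<or> (f ^^ j) ` {a..<c} \<subseteq> {c<..1}"
proof (cases j)
  case 0
  then show ?thesis using ab_range by auto
next
  case (Suc i)
  have "(f ^^ j) ` {a..<c} \<subseteq> (f ^^ i) ` {z (n - 1)..1}"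
    using f_left_gap by (auto simp: Suc funpow_swap1)
  then show ?thesis using funpow_right_end_branch[of i] assms Suc
    by (metis less_diff_conv Suc_eq_plus1 subset_trans)
qed

lemma left_subset: "{a..<c} \<subseteq> {0..1}"
  using ab_range c by auto

lemma continuous_left: "j \<le> n \<Longrightarrow> continuous_on {a..<c} (f ^^ j)"
  using funpow_branches(1)[OF left_subset] funpow_left_branch by simp

lemma expand_left_funpow:
  "j \<le> n \<Longrightarrow> a \<le> x \<Longrightarrow> x \<le> y \<Longrightarrow> y < c \<Longrightarrow> \<mu> ^ j * (y - x) \<le> (f ^^ j) y - (f ^^ j) x"
  using funpow_branches(2)[OF left_subset, of j x y] funpow_left_branch by simp

text \<open>\<open>f x\<close> tends to 1 inside \<open>{z (n - 1)..1}\<close>, where the remaining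
  iterate is continuous. The punctured filter at 1 also demands \<open>f x \<noteq> 1\<close>, which
  strict growth of the branch provides.\<close>

lemma tendsto_left:
  assumes "1 \<le> j" "j \<le> n"
  shows "((f ^^ j) \<longlongrightarrow> (f ^^ (j - 1)) 1) (at_left c)"
proof -
  have sub: "{z (n - 1)..1} \<subseteq> {0..1}"
    using z_range[of "n - 1"] k by auto
  have "continuous_on {z (n - 1)..1} (f ^^ (j - 1))"
    using funpow_right_end_branch assms by (intro funpow_branches(1)[OF sub]) simp
  then have "((f ^^ (j - 1)) \<longlongrightarrow> (f ^^ (j - 1)) 1) (at 1 within {z (n - 1)..1})"
    using z_range[of "n - 1"] k by (simp add: continuous_on_def)
  moreover have ev: "\<forall>\<^sub>F x in at_left c. a < x \<and> x < c"
    using eventually_at_leftI[of a c] c_between by simp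
  have "\<forall>\<^sub>F x in at_left c. f x \<in> {z (n - 1)..1} \<and> f x \<noteq> 1"
    using ev
  proof eventually_elim
    case (elim x)
    then obtain y where y: "x < y" "y < c" using dense by blast
    have "\<mu> * (y - x) > 0" using \<mu> y by simp
    then have "f x < f y" using expand_left[of x y] elim y ab_range by simp
    then show ?case using f_left_gap[of x] f_left_gap[of y] elim y by auto
  qed
  then have "filterlim f (at 1 within {z (n - 1)..1}) (at_left c)"
    using tendsto(1) by (simp add: filterlim_at)
  ultimately have "((\<lambda>x. (f ^^ (j - 1)) (f x)) \<longlongrightarrow> (f ^^ (j - 1)) 1) (at_left c)"
    by (rule filterlim_compose)
  moreover have "(f ^^ (j - 1)) (f x) = (f ^^ j) x" for x
    using assms by (metis Suc_diff_1 comp_apply funpow_Suc_right less_eq_Suc_le One_nat_def)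
  ultimately show ?thesis by simp
qed

lemma n_ge_2: "n \<ge> 2"
  using k by simp

lemma funpow_n_a: "(f ^^ n) a = a" and funpow_n_b: "(f ^^ n) b = b"
  using funpow_n_z[of _ 1] k by simp_all

lemma mu_pow_n: "\<mu> ^ n > 1"
  using \<mu> n_ge_2 by (intro one_less_power) auto

lemma expand_from_a:
  assumes "a \<le> x" "x < c"
  shows "\<mu> * (x - a) \<le> (f ^^ n) x - a"
proof -
  have "\<mu> ^ 1 \<le> \<mu> ^ n"
    using \<mu> n_ge_2 by (intro power_increasing) auto
  then have "\<mu> * (x - a) \<le> \<mu> ^ n * (x - a)"
    using assms by (intro mult_right_mono) auto
  then show ?thesis
    using expand_left_funpow[of n a x] assms funpow_n_a by simp
qed

lemma funpow_n_greater:
  assumes "a < x" "x < c"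
  shows "x < (f ^^ n) x"
proof -
  have "1 * (x - a) < \<mu> * (x - a)"
    using assms \<mu> by (intro mult_strict_right_mono) auto
  also have "\<dots> \<le> (f ^^ n) x - a"
    using expand_from_a[of x] assms by simp
  finally show ?thesis by simp
qed

lemma funpow_n_strict_left:
  assumes "a \<le> x" "x < y" "y < c"
  shows "(f ^^ n) x < (f ^^ n) y"
proof -
  have "0 < \<mu> ^ n * (y - x)" using mu_pow_n assms by simp
  then show ?thesis using expand_left_funpow[of n x y] assms by simp
qed

lemma funpow_n_less_v:
  assumes "a \<le> x" "x < c"
  shows "(f ^^ n) x < v"
proof -
  obtain y where y: "x < y" "y < c" using dense assms by blast
  have "\<forall>\<^sub>F t in at_left c. (f ^^ n) y \<le> (f ^^ n) t"
    using funpow_n_strict_left assms y by (intro eventually_at_leftI[of y]) (auto intro: less_imp_le)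
  then have "(f ^^ n) y \<le> v"
    using tendsto_left[of n] n_ge_2 by (intro tendsto_lowerbound[of "f ^^ n" _ "at_left c"]) auto
  then show ?thesis using funpow_n_strict_left[of x y] assms y by simp
qed

lemma c_less_v: "c < v"
proof -
  \<comment> \<open>Chosen with \<open>\<mu> * (x - a) = c - a\<close>: expansion from the fixed
    point \<open>a\<close> already lifts the image of \<open>x\<close> to \<open>c\<close> or
    beyond, and this image is below \<open>v\<close>.\<close>
  define x where "x = a + (c - a) / \<mu>"
  have "c - a > 0" using c_between by simp
  then have "1 * (c - a) < \<mu> * (c - a)" "0 < (c - a) / \<mu>"
    using \<mu> by (auto intro!: mult_strict_right_mono simp del: mult_1_left)
  then have "(c - a) / \<mu> < c - a" "0 < (c - a) / \<mu>"
    using \<mu> by (simp_all only: pos_divide_less_eq mult.commute mult_1_left)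
  then have x: "a < x" "x < c" "\<mu> * (x - a) = c - a"
    using \<mu> by (simp_all add: x_def)
  then show ?thesis
    using expand_from_a[of x] funpow_n_less_v[of x] by simp
qed

text \<open>The point 1 starts in gap 0, and \<open>n - 1\<close> shifts by \<open>k\<close> amount
  to one shift by \<open>-k\<close>, which leads to the critical gap.\<close>

lemma v_le_b: "v \<le> b"
proof -
  have "1 \<in> gap 0" using z_range[of "n - 1"] k by (simp add: gap_def)
  then have "v \<in> gap ((n - 1) * k mod n)"
    using funpow_gap[of 1 0 "n - 1"] k by simp
  moreover have "(n - 1) * k mod n = n - k"
  proof -
    have "(n - 1) * k = (n - k) + (k - 1) * n"
      using k by (cases n; cases k) (auto simp: algebra_simps)
    then show ?thesis using k by (simp only: mod_mult_self1 mod_less)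
  qed
  ultimately show ?thesis by (simp add: gap_critical)
qed

text \<open>The intermediate value theorem between the fixed point \<open>a\<close> and the left
  limit \<open>v\<close>. The one-sided filters are recorded so that preimages can be composed
  without losing the side of approach.\<close>

lemma left_surj:
  assumes "a < y" "y < v"
  obtains x where "a < x" "x < c" "(f ^^ n) x = y"
    "filterlim (f ^^ n) (at_left y) (at_left x)" "filterlim (f ^^ n) (at_right y) (at_right x)"
proof -
  have "\<forall>\<^sub>F t in at_left c. y < (f ^^ n) t \<and> a < t \<and> t < c"
    using order_tendstoD(1)[OF tendsto_left[of n] assms(2)] n_ge_2 eventually_at_leftI[of a c]
      c_between by (simp add: eventually_conj)
  then obtain w where w: "y < (f ^^ n) w" "a < w" "w < c"
    using eventually_happens by fastforce
  have "continuous_on {a..w} (f ^^ n)"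
    using continuous_left[of n] w by (auto intro: continuous_on_subset)
  then obtain x where x: "a \<le> x" "x \<le> w" "(f ^^ n) x = y"
    using IVT'[of "f ^^ n" a y w] assms(1) w funpow_n_a by auto
  then have ax: "a < x" using assms(1) funpow_n_a by (cases "x = a") auto
  have "isCont (f ^^ n) x"
    using continuous_on_interior[of "{a..<c}" "f ^^ n" x] continuous_left[of n] ax x(2) w(3) by simp
  then have lim: "((f ^^ n) \<longlongrightarrow> y) (at x within A)" for A
    using x(3) by (metis continuous_at tendsto_within_subset top_greatest)
  have "\<forall>\<^sub>F t in at_left x. (f ^^ n) t \<in> {..<y} \<and> (f ^^ n) t \<noteq> y"
    using funpow_n_strict_left[of _ x] x w ax by (intro eventually_at_leftI[of a]) (auto simp: less_le)
  moreover have "\<forall>\<^sub>F t in at_right x. (f ^^ n) t \<in> {y<..} \<and> (f ^^ n) t \<noteq> y"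
  proof (rule eventually_at_rightI)
    fix t assume "t \<in> {x<..<c}"
    then show "(f ^^ n) t \<in> {y<..} \<and> (f ^^ n) t \<noteq> y"
      using funpow_n_strict_left[of x t] x by auto
  qed (use x w in simp)
  ultimately show thesis
    using that[OF ax _ x(3)] x(2) w(3) lim by (simp add: filterlim_at)
qed

lemma critical_preimage:
  assumes "0 < q"
  obtains x where "a < x" "x < c" "(f ^^ (q * n)) x = c"
    "filterlim (f ^^ (q * n)) (at_left c) (at_left x)"
    "filterlim (f ^^ (q * n)) (at_right c) (at_right x)"
  using assms
proof (induction q arbitrary: thesis rule: nat_induct_non_zero)
  case 1
  show ?case
    using left_surj[of c] c_between c_less_v 1 by (metis mult_1)
next
  case (Suc q)
  obtain x where x: "a < x" "x < c" "(f ^^ (q * n)) x = c"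
    "filterlim (f ^^ (q * n)) (at_left c) (at_left x)"
    "filterlim (f ^^ (q * n)) (at_right c) (at_right x)"
    using Suc.IH by blast
  obtain y where y: "a < y" "y < c" "(f ^^ n) y = x"
    "filterlim (f ^^ n) (at_left x) (at_left y)" "filterlim (f ^^ n) (at_right x) (at_right y)"
    using left_surj[of x] x c_less_v by auto
  have "f ^^ (Suc q * n) = (\<lambda>t. (f ^^ (q * n)) ((f ^^ n) t))"
    using funpow_add[of "q * n" n f] by (simp add: fun_eq_iff add.commute)
  then show ?case
    using Suc.prems[of y] x y filterlim_compose[OF x(4) y(4)] filterlim_compose[OF x(5) y(5)]
    by simp
qed

text \<open>The points \<open>a\<close> and \<open>b\<close> of the reflected cycle are thereby
  recognised as \<open>1 - b\<close> and \<open>1 - a\<close>.\<close>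

lemma reflect_index:
  "n - 1 - (n - (n - k) - 1) = n - k" "n - 1 - (n - (n - k)) = n - k - 1"
  using k by simp_all

lemmas reflect_simps = reflect_index funpow_reflect

section \<open>Facts to the right of \<open>c\<close>, by reflection\<close>

lemma u_less_c: "u < c"
  using primary_cycle.c_less_v[OF reflect_primary, unfolded reflect_simps]
  by (simp add: reflect_def[of _ 1])

lemma a_le_u: "a \<le> u"
  using primary_cycle.v_le_b[OF reflect_primary, unfolded reflect_simps]
  by (simp add: reflect_def[of _ 1])

lemma tendsto_right:
  assumes "1 \<le> j" "j \<le> n"
  shows "((f ^^ j) \<longlongrightarrow> (f ^^ (j - 1)) 0) (at_right c)"
  using tendsto_reflect(2)[OF primary_cycle.tendsto_left[OF reflect_primary assms, unfolded reflect_simps]]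
  by (simp add: reflect_def)

lemma continuous_right: "j \<le> n \<Longrightarrow> continuous_on {c<..b} (f ^^ j)"
  using continuous_on_reflect[OF primary_cycle.continuous_left[OF reflect_primary, unfolded reflect_simps], of j "{c<..b}"]
  by simp

lemma funpow_n_less: "c < x \<Longrightarrow> x < b \<Longrightarrow> (f ^^ n) x < x"
  using primary_cycle.funpow_n_greater[OF reflect_primary, of "1 - x", unfolded reflect_simps]
  by (simp add: reflect_def)

lemma funpow_n_strict_right: "c < x \<Longrightarrow> x < y \<Longrightarrow> y \<le> b \<Longrightarrow> (f ^^ n) x < (f ^^ n) y"
  using primary_cycle.funpow_n_strict_left[OF reflect_primary, of "1 - y" "1 - x", unfolded reflect_simps]
  by (simp add: reflect_def)

lemma funpow_n_greater_u: "c < x \<Longrightarrow> x \<le> b \<Longrightarrow> u < (f ^^ n) x"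
  using primary_cycle.funpow_n_less_v[OF reflect_primary, of "1 - x", unfolded reflect_simps]
  by (simp add: reflect_def)

lemma funpow_n_ge: "a \<le> x \<Longrightarrow> x < c \<Longrightarrow> x \<le> (f ^^ n) x"
  using funpow_n_greater[of x] funpow_n_a by (cases "x = a") auto

lemma funpow_n_le: "c < x \<Longrightarrow> x \<le> b \<Longrightarrow> (f ^^ n) x \<le> x"
  using funpow_n_less[of x] funpow_n_b by (cases "x = b") auto

lemma lorenz_on_return:
  assumes f: "lorenz_on 0 1 f c"
    and g_left: "\<And>x. x \<in> {u..<c} \<Longrightarrow> g x = (f ^^ n) x"
    and g_right: "\<And>x. x \<in> {c<..v} \<Longrightarrow> g x = (f ^^ n) x"
    and g_crit: "g c \<in> {u, v}"
  shows "lorenz_on u v g c"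
proof -
  have "continuous_on {u..<c} g"
    by (rule continuous_on_eq[OF continuous_on_subset[OF continuous_left[of n]]])
      (use g_left a_le_u in auto)
  moreover have "continuous_on {c<..v} g"
    by (rule continuous_on_eq[OF continuous_on_subset[OF continuous_right[of n]]])
      (use g_right v_le_b in auto)
  moreover have "strict_mono_on {u..<c} g"
    using g_left a_le_u by (intro strict_mono_onI) (auto intro!: funpow_n_strict_left)
  moreover have "strict_mono_on {c<..v} g"
    using g_right v_le_b by (intro strict_mono_onI) (auto intro!: funpow_n_strict_right)
  moreover have "(g \<longlongrightarrow> v) (at_left c)"
  proof (rule Lim_transform_eventually)
    show "((f ^^ n) \<longlongrightarrow> v) (at_left c)" using tendsto_left[of n] n_ge_2 by simp
    show "\<forall>\<^sub>F x in at_left c. (f ^^ n) x = g x"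
      using u_less_c g_left by (intro eventually_at_leftI[of u]) auto
  qed
  moreover have "(g \<longlongrightarrow> u) (at_right c)"
  proof (rule Lim_transform_eventually)
    show "((f ^^ n) \<longlongrightarrow> u) (at_right c)" using tendsto_right[of n] n_ge_2 by simp
    show "\<forall>\<^sub>F x in at_right c. (f ^^ n) x = g x"
      using c_less_v g_right by (intro eventually_at_rightI[of _ v]) auto
  qed
  \<comment> \<open>Points left of \<open>c\<close> do not move left and stay below
    \<open>v\<close>; points right of \<open>c\<close> do not move right and stay above
    \<open>u\<close>.\<close>
  moreover have "g x \<in> {u..v}" if x: "x \<in> {u..v}" for x
  proof -
    consider "x < c" | "x = c" | "c < x" by linarith
    then show ?thesis
    proof cases
      case 1
      then show ?thesis
        using x g_left[of x] funpow_n_ge[of x] funpow_n_less_v[of x] a_le_u by simp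
    next
      case 2
      then show ?thesis using g_crit x by auto
    next
      case 3
      then show ?thesis
        using x g_right[of x] funpow_n_le[of x] funpow_n_greater_u[of x] v_le_b by simp
    qed
  qed
  then have "g ` {u..v} \<subseteq> {u..v}" by blast
  moreover have "\<exists>F \<mu>. finite F \<and> \<mu> > 1 \<and>
      (\<forall>x\<in>{u<..<v} - F. \<exists>D\<ge>\<mu>. (g has_real_derivative D) (at x))"
  proof -
    \<comment> \<open>A new constant that hides the one of the locale: here a bound on derivatives
      is required, not an expansion inequality.\<close>
    obtain F \<mu> where F: "finite F" "\<mu> > 1"
        "\<And>x. x \<in> {0<..<1} - F \<Longrightarrow> \<exists>D\<ge>\<mu> ^ n. ((f ^^ n) has_real_derivative D) (at x)"
      using lorenz_on_deriv_funpow[OF f, of n] by blast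
    have "\<exists>D\<ge>\<mu> ^ n. (g has_real_derivative D) (at x)" if x: "x \<in> {u<..<v} - (F \<union> {c})" for x
    proof -
      have "x \<in> {0<..<1} - F" using x a_le_u v_le_b ab_range by auto
      then obtain D where D: "D \<ge> \<mu> ^ n" "((f ^^ n) has_real_derivative D) (at x)"
        using F(3) by blast
      have "(g has_real_derivative D) (at x)"
      proof (rule has_field_derivative_transform_within_open[OF D(2)])
        show "open ({u<..<c} \<union> {c<..<v})" by (intro open_Un open_greaterThanLessThan)
        show "x \<in> {u<..<c} \<union> {c<..<v}" using x by auto
      qed (use g_left g_right in auto)
      then show ?thesis using D(1) by blast
    qed
    moreover have "\<mu> ^ n > 1"
      using F(2) n_ge_2 by (intro one_less_power) auto
    ultimately show ?thesis
      using F(1) by (intro exI[of _ "F \<union> {c}"] exI[of _ "\<mu> ^ n"]) blast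
  qed
  moreover have "c \<in> {u<..<v}" using u_less_c c_less_v by simp
  ultimately show ?thesis
    using g_crit unfolding lorenz_on_def by blast
qed

end

section \<open>Return times of other renormalizations\<close>

lemma lorenz_on_reflect:
  assumes g: "lorenz_on u v g c"
  shows "lorenz_on (1 - v) (1 - u) (reflect g) (1 - c)"
proof -
  have g': "g ` {u..v} \<subseteq> {u..v}" "u < c" "c < v" "continuous_on {u..<c} g" "continuous_on {c<..v} g"
      "strict_mono_on {u..<c} g" "strict_mono_on {c<..v} g"
      "(g \<longlongrightarrow> v) (at_left c)" "(g \<longlongrightarrow> u) (at_right c)" "g c = u \<or> g c = v"
    using g by (simp_all add: lorenz_on_def)
  obtain F \<mu> where F: "finite F" "\<mu> > 1"
      "\<And>x. x \<in> {u<..<v} - F \<Longrightarrow> \<exists>D\<ge>\<mu>. (g has_real_derivative D) (at x)"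
    using g unfolding lorenz_on_def by blast
  have "\<exists>D\<ge>\<mu>. (reflect g has_real_derivative D) (at x)"
    if x: "x \<in> {1 - v<..<1 - u} - (\<lambda>x. 1 - x) ` F" for x
  proof -
    have "1 - x \<notin> F" using x by force
    then have "1 - x \<in> {u<..<v} - F" using x by auto
    then obtain D where D: "D \<ge> \<mu>" "(g has_real_derivative D) (at (1 - x))" using F(3) by blast
    have "((\<lambda>x. 1 - x) has_real_derivative - 1) (at x)"
      by (auto intro!: derivative_eq_intros)
    then have "((\<lambda>x. g (1 - x)) has_real_derivative D * - 1) (at x)"
      by (rule DERIV_chain2[where f = g and g = "\<lambda>x. 1 - x", OF D(2)])
    then have "(reflect g has_real_derivative D) (at x)"
      unfolding reflect_def by (auto intro!: derivative_eq_intros)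
    then show ?thesis using D(1) by blast
  qed
  then have "\<exists>F \<mu>. finite F \<and> \<mu> > 1 \<and>
      (\<forall>x\<in>{1 - v<..<1 - u} - F. \<exists>D\<ge>\<mu>. (reflect g has_real_derivative D) (at x))"
    using F(1,2) by (intro exI[of _ "(\<lambda>x. 1 - x) ` F"] exI[of _ \<mu>]) blast
  moreover have "continuous_on {1 - v..<1 - c} (reflect g)"
    by (rule continuous_on_reflect[OF g'(5)]) auto
  moreover have "continuous_on {1 - c<..1 - u} (reflect g)"
    by (rule continuous_on_reflect[OF g'(4)]) auto
  moreover have "strict_mono_on {1 - v..<1 - c} (reflect g)"
    unfolding reflect_def by (intro strict_mono_onI) (auto intro!: strict_mono_onD[OF g'(7)])
  moreover have "strict_mono_on {1 - c<..1 - u} (reflect g)"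
    unfolding reflect_def by (intro strict_mono_onI) (auto intro!: strict_mono_onD[OF g'(6)])
  moreover have "reflect g ` {1 - v..1 - u} \<subseteq> {1 - v..1 - u}"
  proof -
    have "g (1 - x) \<in> {u..v}" if "x \<in> {1 - v..1 - u}" for x
      using g'(1) that by (simp add: image_subset_iff)
    then show ?thesis by (auto simp: reflect_def)
  qed
  moreover have "reflect g (1 - c) \<in> {1 - v, 1 - u}"
    using g'(10) by (auto simp: reflect_def)
  ultimately show ?thesis
    using g'(2,3) tendsto_reflect(1)[OF g'(9)] tendsto_reflect(2)[OF g'(8)]
    unfolding lorenz_on_def by simp
qed

text \<open>The part of the renormalization data \<open>(h^l, _)\<close> on \<open>[p,q]\<close> which lives to the left of \<open>c\<close>;
  the part to the right of \<open>c\<close> is a left part of the reflected map.\<close>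

definition left_return :: "(real \<Rightarrow> real) \<Rightarrow> real \<Rightarrow> real \<Rightarrow> real \<Rightarrow> nat \<Rightarrow> bool" where
  "left_return h c p q l \<longleftrightarrow>
     p < c \<and> c < q \<and> continuous_on {p<..<c} (h ^^ l) \<and>
     (\<forall>x\<in>{p<..<c}. p \<le> (h ^^ l) x \<and> (h ^^ l) x < q) \<and>
     ((h ^^ l) \<longlongrightarrow> q) (at_left c) \<and>
     (\<exists>\<kappa>>1. \<forall>x y. p < x \<longrightarrow> x \<le> y \<longrightarrow> y < c \<longrightarrow> \<kappa> * (y - x) \<le> (h ^^ l) y - (h ^^ l) x)"

text \<open>Only the open interval \<open>{p<..<c}\<close> enters, because at \<open>p\<close> a
  renormalization may be prescribed through a one-sided limit. The upper bound \<open>q\<close> is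
  strict because \<open>g\<close> still increases beyond each point below \<open>c\<close>.\<close>

lemma left_return_if_lorenz_on:
  assumes g: "lorenz_on p q g c" and eq: "\<And>x. x \<in> {p<..<c} \<Longrightarrow> g x = (h ^^ l) x"
  shows "left_return h c p q l"
proof -
  have g': "g ` {p..q} \<subseteq> {p..q}" "p < c" "c < q" "continuous_on {p..<c} g"
      "strict_mono_on {p..<c} g" "(g \<longlongrightarrow> q) (at_left c)"
    using g by (simp_all add: lorenz_on_def)
  obtain \<kappa> where \<kappa>: "\<kappa> > 1"
      "\<And>x y. p \<le> x \<Longrightarrow> x \<le> y \<Longrightarrow> y < c \<Longrightarrow> \<kappa> * (y - x) \<le> g y - g x"
      "\<And>x y. c < x \<Longrightarrow> x \<le> y \<Longrightarrow> y \<le> q \<Longrightarrow> \<kappa> * (y - x) \<le> g y - g x"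
    using lorenz_on_expanding[OF g] by blast
  have "continuous_on {p<..<c} (h ^^ l)"
    by (rule continuous_on_eq[OF continuous_on_subset[OF g'(4)]]) (auto simp: eq)
  moreover have "p \<le> (h ^^ l) x \<and> (h ^^ l) x < q" if x: "x \<in> {p<..<c}" for x
  proof -
    obtain y where y: "x < y" "y < c" using x dense by auto
    have "g x < g y" using x y by (intro strict_mono_onD[OF g'(5)]) auto
    moreover have "g x \<in> {p..q}" "g y \<in> {p..q}"
      using g' x y by (auto simp: image_subset_iff)
    ultimately show ?thesis using eq[OF x] by simp
  qed
  moreover have "((h ^^ l) \<longlongrightarrow> q) (at_left c)"
  proof (rule Lim_transform_eventually[OF g'(6)])
    show "\<forall>\<^sub>F x in at_left c. g x = (h ^^ l) x"
      using eq g'(2) by (intro eventually_at_leftI[of p]) auto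
  qed
  moreover have "\<exists>\<kappa>>1. \<forall>x y. p < x \<longrightarrow> x \<le> y \<longrightarrow> y < c \<longrightarrow> \<kappa> * (y - x) \<le> (h ^^ l) y - (h ^^ l) x"
  proof (intro exI[of _ \<kappa>] conjI allI impI)
    fix x y assume "p < x" "x \<le> y" "y < c"
    then show "\<kappa> * (y - x) \<le> (h ^^ l) y - (h ^^ l) x"
      using \<kappa>(2)[of x y] eq[of x] eq[of y] by simp
  qed fact
  ultimately show ?thesis
    using g'(2,3) unfolding left_return_def by blast
qed

context primary_cycle
begin

text \<open>Points close to \<open>c\<close> on the left are mapped into \<open>(c,q)\<close>, hence
  return to the open critical gap.\<close>

lemma left_return_dvd:
  assumes "left_return f c p q l" "q \<le> b"
  shows "n dvd l"
proof -
  have lr: "p < c" "c < q" "\<And>x. x \<in> {p<..<c} \<Longrightarrow> (f ^^ l) x < q" "((f ^^ l) \<longlongrightarrow> q) (at_left c)"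
    using assms(1) by (auto simp: left_return_def)
  have "\<forall>\<^sub>F x in at_left c. c < (f ^^ l) x \<and> x \<in> {max a p<..<c}"
    using order_tendstoD(1)[OF lr(4,2)] eventually_at_left_real[of "max a p" c] c_between lr(1)
    by (simp add: eventually_conj)
  then obtain x where "c < (f ^^ l) x" "x \<in> {max a p<..<c}"
    using eventually_happens by fastforce
  then show ?thesis
    using lr(3)[of x] assms(2) c_between by (intro return_to_critical_gap[of x]) auto
qed

text \<open>If \<open>p < a\<close>, the iterate fixes the interior point \<open>a\<close> and
  pushes points slightly above \<open>p\<close> below \<open>p\<close>.\<close>

lemma left_return_ge:
  assumes "left_return f c p q l" "n dvd l"
  shows "a \<le> p"
proof (rule ccontr)
  assume "\<not> a \<le> p"
  then have ap: "0 < a - p" by simp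
  obtain \<kappa> where \<kappa>: "\<kappa> > 1" "\<And>x y. p < x \<Longrightarrow> x \<le> y \<Longrightarrow> y < c \<Longrightarrow> \<kappa> * (y - x) \<le> (f ^^ l) y - (f ^^ l) x"
    using assms(1) unfolding left_return_def by blast
  have lr: "\<And>x. x \<in> {p<..<c} \<Longrightarrow> p \<le> (f ^^ l) x"
    using assms(1) by (auto simp: left_return_def)
  have "1 * (a - p) < \<kappa> * (a - p)"
    using \<kappa>(1) ap by (intro mult_strict_right_mono) auto
  then have "(a - p) / \<kappa> < a - p"
    using \<kappa>(1) by (simp only: pos_divide_less_eq mult.commute mult_1_left)
  \<comment> \<open>With \<open>d < a - p < \<kappa> * d\<close>, the point \<open>a - d\<close>
    lies in the domain but its image falls below \<open>p\<close>.\<close>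
  then obtain d where d: "(a - p) / \<kappa> < d" "d < a - p" using dense by blast
  have "0 < (a - p) / \<kappa>" using ap \<kappa>(1) by simp
  then have d0: "0 < d" using d(1) by linarith
  have "a - p < \<kappa> * d"
    using d(1) \<kappa>(1) by (simp add: pos_divide_less_eq mult.commute)
  moreover have "(f ^^ l) a = a"
    using assms(2) funpow_n_z[of "n - k - 1"] k by (auto simp: mult.commute elim!: dvdE)
  ultimately show False
    using \<kappa>(2)[of "a - d" a] lr[of "a - d"] d(2) d0 c_between by auto
qed

text \<open>Orbits that meet stay together, which would force \<open>u = v\<close>.\<close>

lemma ends_neq:
  assumes "j \<le> n - 1"
  shows "(f ^^ j) 0 \<noteq> (f ^^ j) 1"
proof
  assume *: "(f ^^ j) 0 = (f ^^ j) 1"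
  have "f ^^ (n - 1) = (f ^^ (n - 1 - j)) \<circ> (f ^^ j)"
    using assms by (metis funpow_add le_add_diff_inverse2)
  then have "u = v" using * by simp
  then show False using u_less_c c_less_v by simp
qed

text \<open>If \<open>l = q n + \<rho>\<close> with \<open>0 < \<rho> < n\<close>, a \<open>q n\<close>-fold preimage of \<open>c\<close> in \<open>(a,c)\<close> is a
  discontinuity of \<open>f^l\<close>, whose one-sided limits there are \<open>f^(\<rho>-1)(1)\<close> and \<open>f^(\<rho>-1)(0)\<close>.\<close>

lemma left_return_dvd_if_ge:
  assumes "left_return f c p q l" "n \<le> l" "p \<le> a"
  shows "n dvd l"
proof (rule ccontr)
  assume "\<not> n dvd l"
  define \<rho> where "\<rho> = l mod n"
  have \<rho>: "1 \<le> \<rho>" "\<rho> < n"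
    using \<open>\<not> n dvd l\<close> k by (auto simp: \<rho>_def dvd_eq_mod_eq_0 Suc_le_eq)
  have "0 < l div n" using assms(2) k by (simp add: div_greater_zero_iff)
  then obtain x where x: "a < x" "x < c"
    "filterlim (f ^^ (l div n * n)) (at_left c) (at_left x)"
    "filterlim (f ^^ (l div n * n)) (at_right c) (at_right x)"
    using critical_preimage by metis
  have "f ^^ l = (f ^^ \<rho>) \<circ> (f ^^ (l div n * n))"
    using funpow_add[of \<rho> "l div n * n" f] by (simp add: \<rho>_def)
  then have "((f ^^ l) \<longlongrightarrow> (f ^^ (\<rho> - 1)) 1) (at_left x)"
    and "((f ^^ l) \<longlongrightarrow> (f ^^ (\<rho> - 1)) 0) (at_right x)"
    using filterlim_compose[OF tendsto_left[of \<rho>] x(3)] filterlim_compose[OF tendsto_right[of \<rho>] x(4)] \<rho>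
    by (simp_all add: o_def)
  moreover have "isCont (f ^^ l) x"
    using assms(1,3) x(1,2) continuous_on_interior[of "{p<..<c}" "f ^^ l" x]
    by (simp add: left_return_def)
  then have "((f ^^ l) \<longlongrightarrow> (f ^^ l) x) (at_left x)" "((f ^^ l) \<longlongrightarrow> (f ^^ l) x) (at_right x)"
    by (simp_all add: isCont_def filterlim_at_split)
  ultimately have "(f ^^ (\<rho> - 1)) 0 = (f ^^ (\<rho> - 1)) 1"
    using tendsto_unique trivial_limit_at_left_real trivial_limit_at_right_real by metis
  moreover have "\<rho> - 1 \<le> n - 1" using \<rho> by simp
  ultimately show False using ends_neq by blast
qed

lemma return_times_dvd:
  assumes left: "left_return f c p q l"
    and right: "left_return (reflect f) (1 - c) (1 - q) (1 - p) r"
    and ge: "l \<ge> n \<or> r \<ge> n"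
  shows "n dvd l \<and> n dvd r"
proof -
  note left_facts = left_return_dvd[OF left] left_return_ge[OF left] left_return_dvd_if_ge[OF left]
  have right_facts: "a \<le> p \<Longrightarrow> n dvd r" "n dvd r \<Longrightarrow> q \<le> b" "n \<le> r \<Longrightarrow> b \<le> q \<Longrightarrow> n dvd r"
    using primary_cycle.left_return_dvd[OF reflect_primary right, unfolded reflect_simps]
      primary_cycle.left_return_ge[OF reflect_primary right, unfolded reflect_simps]
      primary_cycle.left_return_dvd_if_ge[OF reflect_primary right, unfolded reflect_simps]
    by auto
  show ?thesis
    \<comment> \<open>The four conditions imply each other cyclically. If the comparison of
      \<open>p\<close> with \<open>a\<close>, or of \<open>b\<close> with \<open>q\<close>, goes the
      way the discontinuity argument cannot use, it is itself one of the four conditions.\<close>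
    using ge left_facts right_facts linear by metis
qed

section \<open>Returning to and escaping into \<open>{u<..<v}\<close>\<close>

lemma funpow_n_in_return:
  assumes "a < u" "v < b" "x \<in> {u<..<v}"
  shows "\<exists>i. (f ^^ Suc i) x \<in> {u<..<v}"
proof -
  have *: "(f ^^ n) y \<in> {u<..<v}" if "y \<in> {u..v}" "y \<noteq> c" for y
  proof (cases "y < c")
    case True
    then show ?thesis using that assms(1) funpow_n_greater[of y] funpow_n_less_v[of y] by simp
  next
    case False
    then show ?thesis using that assms(2) funpow_n_less[of y] funpow_n_greater_u[of y] by simp
  qed
  have n: "n = Suc (n - 1)" using k by simp
  show ?thesis
  proof (cases "x = c")
    case True
    \<comment> \<open>Since \<open>f c\<close> is 0 or 1, the first return of \<open>c\<close> is an
      end point of the interval; \<open>n\<close> further steps lead inside.\<close>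
    have "(f ^^ n) c = (f ^^ (n - 1)) (f c)"
      by (metis n comp_apply funpow_Suc_right)
    then have "(f ^^ n) c \<in> {u, v}" using f_c by auto
    then have "(f ^^ n) ((f ^^ n) c) \<in> {u<..<v}"
      using u_less_c c_less_v by (intro *) auto
    then have "(f ^^ Suc (n - 1 + n)) x \<in> {u<..<v}"
      using n True by (metis add_Suc comp_apply funpow_add)
    then show ?thesis by blast
  next
    case False
    then show ?thesis using *[of x] assms(3) n by (metis greaterThanLessThan_iff atLeastAtMost_iff less_imp_le)
  qed
qed

text \<open>A point that never enters has all its iterates at multiples of \<open>n\<close> in
  \<open>(a,u]\<close>, while their distance to \<open>a\<close> grows at least like
  \<open>\<mu> ^ i\<close>.\<close>

lemma escape_left:
  assumes "a < x" "x < c"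
  shows "\<exists>i. (f ^^ i) x \<in> {u<..<v}"
proof (rule ccontr)
  assume none: "\<not> ?thesis"
  have stay: "y \<le> u" if "y < c" "y = (f ^^ i) x" for y i
    using none that c_less_v by (metis greaterThanLessThan_iff less_trans not_le)
  have "a < (f ^^ (i * n)) x \<and> (f ^^ (i * n)) x \<le> u \<and> \<mu> ^ i * (x - a) \<le> (f ^^ (i * n)) x - a" for i
  proof (induction i)
    case 0
    then show ?case using assms stay[of x 0] by simp
  next
    case (Suc i)
    define y where "y = (f ^^ (i * n)) x"
    have y: "a < y" "y \<le> u" "y < c" "\<mu> ^ i * (x - a) \<le> y - a"
      using Suc u_less_c by (auto simp: y_def)
    have eq: "(f ^^ (Suc i * n)) x = (f ^^ n) y"
      by (simp add: y_def funpow_add)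
    have "(f ^^ n) y < v" "a < (f ^^ n) y"
      using funpow_n_less_v[of y] funpow_n_greater[of y] y by simp_all
    moreover have "(f ^^ n) y \<notin> {u<..<v}" using none eq by metis
    moreover have "\<mu> * (\<mu> ^ i * (x - a)) \<le> \<mu> * (y - a)"
      using y(4) \<mu> by (intro mult_left_mono) auto
    ultimately show ?case
      using eq expand_from_a[of y] y by (simp add: mult.assoc)
  qed
  then have "\<mu> ^ i * (x - a) \<le> u - a" for i by (smt (verit))
  then have "\<mu> ^ i \<le> (u - a) / (x - a)" for i
    using assms(1) by (simp add: pos_le_divide_eq)
  then show False
    using real_arch_pow[OF \<mu>, of "(u - a) / (x - a)"] by (meson not_le)
qed

lemma escape_right: "c < x \<Longrightarrow> x < b \<Longrightarrow> \<exists>i. (f ^^ i) x \<in> {u<..<v}"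
  using primary_cycle.escape_left[OF reflect_primary, unfolded reflect_simps, of "1 - x"]
  by (auto simp: reflect_def)

lemma funpow_z_first: "(f ^^ (n - 2)) (z (k - 1)) = a"
proof -
  have "k - 1 + (n - 2) * k = (n - k - 1) + (k - 1) * n"
    using k by (cases n; cases k; cases "n - 1") (auto simp: algebra_simps)
  then have "(k - 1 + (n - 2) * k) mod n = n - k - 1"
    using k by (simp only: mod_mult_self1 mod_less)
  then show ?thesis using funpow_z[of "k - 1" "n - 2"] k by simp
qed

text \<open>Gap \<open>k\<close> follows gap 0, so its first \<open>n - 2\<close> iterates, starting
  with the gap itself, lie off \<open>c\<close>.\<close>

lemma expand_gap_k:
  assumes "x \<in> gap k" "y \<in> gap k" "x \<le> y"
  shows "\<mu> ^ (n - 2) * (y - x) \<le> (f ^^ (n - 2)) y - (f ^^ (n - 2)) x"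
proof -
  have sub: "gap k \<subseteq> {0..1}"
    using k z_range[of "k - 1"] z_range[of k] by (auto simp: gap_def)
  have "(f ^^ j) ` gap k \<subseteq> {0..<c} \<or> (f ^^ j) ` gap k \<subseteq> {c<..1}" if "j < n - 2" for j
  proof -
    have "(f ^^ j) ` gap k \<subseteq> gap (Suc j * k mod n)"
      using funpow_gap[of _ k j] k by auto
    moreover have "gap (Suc j * k mod n) \<subseteq> {0..<c} \<or> gap (Suc j * k mod n) \<subseteq> {c<..1}"
      using that by (intro orbit_gap_branch) auto
    ultimately show ?thesis by (metis subset_trans)
  qed
  then show ?thesis by (rule funpow_branches(2)[OF sub _ assms])
qed

lemma f_ends_in_gap_k: "f 0 \<in> gap k" "f 1 \<in> gap k"
proof -
  have "0 \<in> gap 0" "1 \<in> gap 0" using z_range[of 0] z_range[of "n - 1"] k by (simp_all add: gap_def)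
  then show "f 0 \<in> gap k" "f 1 \<in> gap k" using f_gap[of _ 0] k by force+
qed

lemma funpow_f_ends: "(f ^^ (n - 2)) (f 0) = u" "(f ^^ (n - 2)) (f 1) = v"
proof -
  have "n - 1 = Suc (n - 2)" using n_ge_2 by simp
  then show "(f ^^ (n - 2)) (f 0) = u" "(f ^^ (n - 2)) (f 1) = v"
    by (metis comp_apply funpow_Suc_right)+
qed

text \<open>The iterate \<open>f ^^ (n - 2)\<close> takes \<open>z (k - 1)\<close> to
  \<open>a\<close> and \<open>f 0\<close> to \<open>u\<close>, and it expands gap \<open>k\<close>,
  which contains both.\<close>

lemma a_less_u:
  assumes "z (k - 1) \<noteq> f 0"
  shows "a < u"
proof -
  have "z (k - 1) \<in> gap k" using z_le[of "k - 1" k] k by (simp add: gap_def)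
  then have "\<mu> ^ (n - 2) * (f 0 - z (k - 1)) \<le> u - a"
    using expand_gap_k[of "z (k - 1)" "f 0"] f_ends f_ends_in_gap_k
    by (simp only: funpow_f_ends funpow_z_first)
  moreover have "0 < \<mu> ^ (n - 2) * (f 0 - z (k - 1))"
    using \<mu> f_ends assms by simp
  ultimately show ?thesis by simp
qed

text \<open>Both values lie in gap \<open>k\<close>, where \<open>f ^^ (n - 2)\<close> preserves
  order and leads to \<open>u < v\<close>. It ensures that the images of the two branches together
  cover \<open>(0,1)\<close>.\<close>

lemma f_0_less_f_1: "f 0 < f 1"
proof (rule ccontr)
  assume "\<not> f 0 < f 1"
  then have "0 \<le> \<mu> ^ (n - 2) * (f 0 - f 1)" "\<mu> ^ (n - 2) * (f 0 - f 1) \<le> u - v"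
    using \<mu> expand_gap_k[of "f 1" "f 0"] f_ends_in_gap_k by (simp_all add: funpow_f_ends)
  then show False using u_less_c c_less_v by linarith
qed

end

section \<open>The sets of points which avoid the return interval\<close>

lemma right_lim_eqI: "(h \<longlongrightarrow> l) (at_right x) \<Longrightarrow> right_lim h x = l"
  unfolding right_lim_def by (intro tendsto_Lim) auto

lemma left_lim_eqI: "(h \<longlongrightarrow> l) (at_left x) \<Longrightarrow> left_lim h x = l"
  unfolding left_lim_def by (intro tendsto_Lim) auto

lemma funpow_in_forward_orbit [intro]: "(h ^^ i) x \<in> forward_orbit h x"
  by (auto simp: forward_orbit_def)

lemma completely_invariant_funpow:
  assumes "completely_invariant S h E" "x \<in> E"
  shows "(h ^^ i) x \<in> E"
  using assms by (induction i) (auto simp: completely_invariant_def)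

lemma in_J_set_iff: "x \<in> J_set f u v \<longleftrightarrow> x \<in> {0..1} \<and> (\<forall>i. (f ^^ i) x \<notin> {u<..<v})"
  by (fastforce simp: J_set_def F_set_def forward_orbit_def)

lemma base_hat_map: "base p \<noteq> c \<Longrightarrow> base (hat_map f c p) = f (base p)"
  by (cases p) auto

context primary_cycle
begin

section \<open>The cycle and the critical orbits in the doubled space\<close>

lemma z_pos: "j < n \<Longrightarrow> 0 < z j"
proof -
  have "0 < z 0"
  proof -
    obtain x where x: "c < x" "x < b" using dense c_between by blast
    have "0 < \<mu> * (b - x)" using x \<mu> by simp
    moreover have "\<mu> * (b - x) \<le> f b - f x" using x ab_range by (intro expand_right) auto
    moreover have "f b = z 0" using f_z_right[of "n - k"] k by simp
    ultimately show ?thesis using f_right_gap[of x] x by simp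
  qed
  then show "j < n \<Longrightarrow> 0 < z j" using z_le[of 0 j] by simp
qed

lemma z_less_1: "j < n \<Longrightarrow> z j < 1"
  using primary_cycle.z_pos[OF reflect_primary, of "n - 1 - j"] by simp

lemma funpow_z_in_cycle: "j < n \<Longrightarrow> \<exists>i<n. (f ^^ m) (z j) = z i"
  using funpow_z[of j m] k by (intro exI[of _ "(j + m * k) mod n"]) simp

lemma z_not_between:
  assumes "j < n"
  shows "\<not> (a < z j \<and> z j < b)"
proof -
  have "j \<le> n - k - 1 \<or> n - k \<le> j" by linarith
  then show ?thesis
    using z_le[of j "n - k - 1"] z_le[of "n - k" j] assms k by auto
qed

lemma z_not_precritical: "j < n \<Longrightarrow> z j \<notin> precritical f c"
  using funpow_z_in_cycle[of j] z_not_between c_between by (auto simp: precritical_def) metis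

lemma hat_map_funpow_z: "j < n \<Longrightarrow> (hat_map f c ^^ i) (Pt (z j)) = Pt ((f ^^ i) (z j))"
proof (induction i)
  case (Suc i)
  obtain m where m: "m < n" "(f ^^ i) (z j) = z m"
    using funpow_z_in_cycle Suc.prems by blast
  then show ?case
    using Suc z_pos[of m] z_less_1[of m] by simp
qed simp

lemma funpow_n_split: "(h ^^ n) x = (h ^^ (n - 2)) (h (h x))" for h :: "'a \<Rightarrow> 'a"
proof -
  have "n = Suc (Suc (n - 2))" using n_ge_2 by simp
  then show ?thesis by (metis comp_apply funpow_Suc_right)
qed

lemma funpow_z_second: "(f ^^ (n - 2)) (z k) = b"
  using primary_cycle.funpow_z_first[OF reflect_primary, unfolded reflect_simps] k
  by (simp add: reflect_def)

text \<open>The orbit runs from the right copy of \<open>c\<close> to 0 and then to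
  \<open>f 0\<close>, a cycle point. Cycle points are not doubled, so the other \<open>n - 2\<close>
  steps follow \<open>f\<close>.\<close>

lemma hat_map_funpow_n_plus:
  assumes "z (k - 1) = f 0"
  shows "(hat_map f c ^^ n) (PtPlus c) = Pt a"
proof -
  have "k - 1 < n" using k by simp
  then have "f 0 \<notin> precritical f c" "(hat_map f c ^^ (n - 2)) (Pt (f 0)) = Pt a"
    unfolding assms[symmetric] using funpow_z_first by (simp_all add: z_not_precritical hat_map_funpow_z)
  then show ?thesis
    by (simp add: funpow_n_split)
qed

lemma hat_map_funpow_n_minus:
  assumes "z k = f 1"
  shows "(hat_map f c ^^ n) (PtMinus c) = Pt b"
  using z_not_precritical[of k] hat_map_funpow_z[of k "n - 2"] funpow_z_second k
  by (simp add: funpow_n_split assms)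

text \<open>As long as \<open>c\<close> is avoided, \<open>hat_map\<close> projects to
  \<open>f\<close> under \<open>base\<close>; this locates the ends of the doubled interval over
  \<open>u\<close> and \<open>v\<close>.\<close>

lemma funpow_1_neq_c: "j < n - 1 \<Longrightarrow> (f ^^ j) 1 \<noteq> c"
  using funpow_right_end_branch[of j] z_less_1[of "n - 1"] k by fastforce

lemma funpow_0_neq_c: "j < n - 1 \<Longrightarrow> (f ^^ j) 0 \<noteq> c"
  using primary_cycle.funpow_1_neq_c[OF reflect_primary, unfolded reflect_simps, of j]
  by (simp add: reflect_def)

lemma base_hat_map_funpow_1: "j \<le> n - 1 \<Longrightarrow> base ((hat_map f c ^^ j) (Pt 1)) = (f ^^ j) 1"
  by (induction j) (simp_all add: base_hat_map funpow_1_neq_c)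

lemma base_hat_map_funpow_0: "j \<le> n - 1 \<Longrightarrow> base ((hat_map f c ^^ j) (Pt 0)) = (f ^^ j) 0"
  by (induction j) (simp_all add: base_hat_map funpow_0_neq_c)

lemma funpow_n_Suc: "(h ^^ n) x = (h ^^ (n - 1)) (h x)" for h :: "'a \<Rightarrow> 'a"
proof -
  have "n = Suc (n - 1)" using n_ge_2 by simp
  then show ?thesis by (metis comp_apply funpow_Suc_right)
qed

lemma base_hat_map_funpow_n:
  "base ((hat_map f c ^^ n) (PtMinus c)) = v" "base ((hat_map f c ^^ n) (PtPlus c)) = u"
  using base_hat_map_funpow_1[of "n - 1"] base_hat_map_funpow_0[of "n - 1"]
  by (simp_all add: funpow_n_Suc)

lemma v_less_b: "z k \<noteq> f 1 \<Longrightarrow> v < b"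
  using primary_cycle.a_less_u[OF reflect_primary, unfolded reflect_simps] k
  by (simp add: reflect_def)

text \<open>When \<open>u = a\<close>, the base of the lower end does not decide whether
  \<open>a\<close> lies above it. In the case \<open>z (k - 1) = f 0\<close> this end is exactly
  \<open>Pt a\<close>; otherwise its base exceeds \<open>a\<close>. The upper end is treated
  likewise.\<close>

lemma cycle_not_in_hat_F:
  assumes "j < n"
  shows "Pt (z j) \<notin> hat_F_set f c n n"
proof
  assume "Pt (z j) \<in> hat_F_set f c n n"
  then obtain i where i: "doubled_less ((hat_map f c ^^ n) (PtPlus c)) (Pt (z i))"
      "doubled_less (Pt (z i)) ((hat_map f c ^^ n) (PtMinus c))" "i < n"
    using funpow_z_in_cycle[OF assms] assms
    by (auto simp: hat_F_set_def forward_orbit_def hat_map_funpow_z) metis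
  have "a < z i"
  proof (cases "z (k - 1) = f 0")
    case True
    then show ?thesis using i(1) by (simp add: hat_map_funpow_n_plus doubled_less_def)
  next
    case False
    then show ?thesis using i(1) a_less_u base_hat_map_funpow_n(2) by (auto simp: doubled_less_def)
  qed
  moreover have "z i < b"
  proof (cases "z k = f 1")
    case True
    then show ?thesis using i(2) by (simp add: hat_map_funpow_n_minus doubled_less_def)
  next
    case False
    then show ?thesis using i(2) v_less_b base_hat_map_funpow_n(1) by (auto simp: doubled_less_def)
  qed
  ultimately show False using z_not_between i(3) by blast
qed

lemma critical_in_hat_F: "PtPlus c \<in> hat_F_set f c n n" "PtMinus c \<in> hat_F_set f c n n"
proof -
  have "c \<in> precritical f c"
    using c by (auto simp: precritical_def intro!: exI[of _ 0])
  then have *: "PtPlus c \<in> doubled_space f c" "PtMinus c \<in> doubled_space f c"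
    by (simp_all add: doubled_space_def)
  have "p \<in> hat_F_set f c n n" if "p \<in> doubled_space f c" "base p = c" for p
  proof -
    have "doubled_less ((hat_map f c ^^ n) (PtPlus c)) p" "doubled_less p ((hat_map f c ^^ n) (PtMinus c))"
      using that u_less_c c_less_v by (simp_all add: doubled_less_def base_hat_map_funpow_n)
    then show ?thesis
      using that(1) funpow_in_forward_orbit[where i = 0 and h = "hat_map f c" and x = p] by (auto simp: hat_F_set_def)
  qed
  then show "PtPlus c \<in> hat_F_set f c n n" "PtMinus c \<in> hat_F_set f c n n"
    using * by simp_all
qed

lemma hat_F_not_completely_invariant:
  assumes "z (k - 1) = f 0 \<or> z k = f 1"
  shows "\<not> completely_invariant (doubled_space f c) (hat_map f c) (hat_F_set f c n n)"
proof
  assume inv: "completely_invariant (doubled_space f c) (hat_map f c) (hat_F_set f c n n)"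
  show False
    using assms
  proof
    assume "z (k - 1) = f 0"
    then have "a' \<notin> hat_F_set f c n n" if "a' = (hat_map f c ^^ n) (PtPlus c)" for a'
      using cycle_not_in_hat_F[of "n - k - 1"] k by (simp add: that hat_map_funpow_n_plus)
    then show False
      using completely_invariant_funpow[OF inv critical_in_hat_F(1)] by blast
  next
    assume "z k = f 1"
    then have "b' \<notin> hat_F_set f c n n" if "b' = (hat_map f c ^^ n) (PtMinus c)" for b'
      using cycle_not_in_hat_F[of "n - k"] k by (simp add: that hat_map_funpow_n_minus)
    then show False
      using completely_invariant_funpow[OF inv critical_in_hat_F(2)] by blast
  qed
qed

section \<open>Surjectivity of \<open>f\<close> and complete invariance of
  \<open>J_set\<close>\<close>

lemma f_surj_left:
  assumes "f 0 \<le> y" "y < 1"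
  shows "\<exists>x\<in>{0..1}. f x = y"
proof -
  have "\<forall>\<^sub>F x in at_left c. y < f x \<and> x \<in> {0<..<c}"
    using order_tendstoD(1)[OF tendsto(1) assms(2)] eventually_at_left_real[of 0 c] c
    by (simp add: eventually_conj)
  then obtain w where w: "y < f w" "0 < w" "w < c"
    using eventually_happens by fastforce
  have "continuous_on {0..w} f"
    using continuous(1) w by (auto intro: continuous_on_subset)
  then show ?thesis
    using IVT'[of f 0 y w] assms(1) w c by auto
qed

text \<open>The left branch covers \<open>[f 0, 1)\<close>. A smaller \<open>y\<close> is below
  \<open>f 1\<close>, so the right branch reaches it, by reflection.\<close>

lemma f_surj:
  assumes "0 < y" "y < 1"
  shows "\<exists>x\<in>{0..1}. f x = y"
proof (cases "f 0 \<le> y")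
  case True
  then show ?thesis using f_surj_left assms by blast
next
  case False
  then have "\<exists>x\<in>{0..1}. reflect f x = 1 - y"
    using primary_cycle.f_surj_left[OF reflect_primary, of "1 - y"] assms f_0_less_f_1
    by (simp add: reflect_def)
  then obtain x where "x \<in> {0..1}" "f (1 - x) = y" by (auto simp: reflect_def)
  then show ?thesis by (intro bexI[of _ "1 - x"]) auto
qed

lemma z_in_J: "j < n \<Longrightarrow> z j \<in> J_set f u v"
proof -
  assume j: "j < n"
  have "(f ^^ i) (z j) \<notin> {u<..<v}" for i
    using funpow_z_in_cycle[OF j, of i] z_not_between a_le_u v_le_b by force
  then show ?thesis using z_range j by (auto simp: in_J_set_iff)
qed

lemma c_not_in_J: "c \<notin> J_set f u v"
  using u_less_c c_less_v by (auto simp: in_J_set_iff intro!: exI[of _ 0])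

lemma J_completely_invariant:
  assumes "z (k - 1) \<noteq> f 0" "z k \<noteq> f 1"
  shows "completely_invariant {0..1} f (J_set f u v)"
proof -
  note au = a_less_u[OF assms(1)] and vb = v_less_b[OF assms(2)]
  have J_iff: "f x \<in> J_set f u v \<longleftrightarrow> x \<in> J_set f u v" if x: "x \<in> {0..1}" for x
  proof
    assume fx: "f x \<in> J_set f u v"
    have "(f ^^ i) x \<notin> {u<..<v}" for i
    proof (cases i)
      case 0
      \<comment> \<open>If \<open>x\<close> itself were in the interval, it would return at a
        positive time, which is an iterate of \<open>f x\<close>.\<close>
      have "(f ^^ Suc i) x \<notin> {u<..<v}" for i
        using fx unfolding in_J_set_iff funpow_Suc_right comp_def by blast
      then show ?thesis using 0 funpow_n_in_return[OF au vb, of x] by auto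
    next
      case (Suc i)
      then show ?thesis using fx unfolding in_J_set_iff Suc funpow_Suc_right comp_def by blast
    qed
    then show "x \<in> J_set f u v" using x by (simp add: in_J_set_iff)
  next
    assume xJ: "x \<in> J_set f u v"
    have "(f ^^ i) (f x) \<notin> {u<..<v}" for i
      using xJ unfolding in_J_set_iff by (metis comp_apply funpow_Suc_right)
    then show "f x \<in> J_set f u v" using range[OF x] by (simp add: in_J_set_iff)
  qed
  \<comment> \<open>Surjectivity is available only for values strictly between 0 and 1. Both end
    points reach the interval: they go to \<open>u\<close> and \<open>v\<close>, and
    \<open>n\<close> steps later inside.\<close>
  have ends: "0 \<notin> J_set f u v" "1 \<notin> J_set f u v"
  proof -
    have "(f ^^ n) u \<in> {u<..<v}" "(f ^^ n) v \<in> {u<..<v}"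
      using funpow_n_greater[of u] funpow_n_less_v[of u] au u_less_c
        funpow_n_less[of v] funpow_n_greater_u[of v] vb c_less_v by simp_all
    then have "(f ^^ (n + (n - 1))) 0 \<in> {u<..<v}" "(f ^^ (n + (n - 1))) 1 \<in> {u<..<v}"
      by (simp_all only: funpow_add comp_apply)
    then show "0 \<notin> J_set f u v" "1 \<notin> J_set f u v" unfolding in_J_set_iff by blast+
  qed
  have sub: "J_set f u v \<subseteq> {0..1}" by (auto simp: J_set_def)
  have "J_set f u v \<subseteq> f ` J_set f u v"
  proof
    fix y assume y: "y \<in> J_set f u v"
    then have "0 < y" "y < 1" using sub ends by (auto simp: less_le)
    then obtain x where "x \<in> {0..1}" "f x = y" using f_surj by blast
    then show "y \<in> f ` J_set f u v" using J_iff y by blast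
  qed
  moreover have "f ` J_set f u v \<subseteq> J_set f u v" using J_iff sub by blast
  moreover have "{x \<in> {0..1}. f x \<in> J_set f u v} = J_set f u v" using J_iff sub by blast
  moreover have "J_set f u v \<noteq> {}" using z_in_J[of 0] k by auto
  ultimately show ?thesis using sub unfolding completely_invariant_def by blast
qed

section \<open>The neighbours of \<open>c\<close> in \<open>J_set\<close> and the first hitting
  times\<close>

lemma Sup_J_left: "Sup {x \<in> J_set f u v. x < c} = a"
proof (rule cSup_eq_maximum)
  show "a \<in> {x \<in> J_set f u v. x < c}" using z_in_J[of "n - k - 1"] c_between k by simp
  fix x assume "x \<in> {x \<in> J_set f u v. x < c}"
  then show "x \<le> a" using escape_left[of x] by (auto simp: in_J_set_iff simp flip: not_less)
qed

lemma Inf_J_right: "Inf {x \<in> J_set f u v. x > c} = b"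
proof (rule cInf_eq_minimum)
  show "b \<in> {x \<in> J_set f u v. x > c}" using z_in_J[of "n - k"] c_between k by simp
  fix x assume "x \<in> {x \<in> J_set f u v. x > c}"
  then show "b \<le> x" using escape_right[of x] by (auto simp: in_J_set_iff simp flip: not_less)
qed

lemma left_hits_c: "\<exists>x. a < x \<and> x < c \<and> (f ^^ n) x = c"
  using left_surj[of c] c_between c_less_v by metis

text \<open>Before time \<open>n\<close> the image of \<open>{a..<c}\<close> lies in a single
  branch, and branches omit \<open>c\<close>.\<close>

lemma left_hit_time_ge: "a < x \<Longrightarrow> x < c \<Longrightarrow> (f ^^ m) x = c \<Longrightarrow> n \<le> m"
  using funpow_left_branch[of m] by (fastforce simp: not_le[symmetric])

lemma right_hits_c: "\<exists>x. c < x \<and> x < b \<and> (f ^^ n) x = c"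
proof -
  obtain y where "1 - b < y" "y < 1 - c" "(reflect f ^^ n) y = 1 - c"
    using primary_cycle.left_hits_c[OF reflect_primary, unfolded reflect_index] by blast
  then show ?thesis by (intro exI[of _ "1 - y"]) (simp add: funpow_reflect reflect_def)
qed

lemma right_hit_time_ge: "c < x \<Longrightarrow> x < b \<Longrightarrow> (f ^^ m) x = c \<Longrightarrow> n \<le> m"
  using primary_cycle.left_hit_time_ge[OF reflect_primary, unfolded reflect_simps, of "1 - x" m]
  by (simp add: reflect_def)

lemma first_hit_eq_n: "first_hit f c {a<..<c} = n" "first_hit f c {c<..<b} = n"
proof -
  show "first_hit f c {a<..<c} = n"
    unfolding first_hit_def
  proof (rule Least_equality)
    show "\<exists>x\<in>{a<..<c}. (f ^^ n) x = c" using left_hits_c by auto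
  qed (auto intro: left_hit_time_ge)
  show "first_hit f c {c<..<b} = n"
    unfolding first_hit_def
  proof (rule Least_equality)
    show "\<exists>x\<in>{c<..<b}. (f ^^ n) x = c" using right_hits_c by auto
  qed (auto intro: right_hit_time_ge)
qed

lemma R_map_J:
  assumes "\<And>x. x \<in> {u..<c} \<Longrightarrow> g x = (f ^^ n) x" "\<And>x. x \<in> {c<..v} \<Longrightarrow> g x = (f ^^ n) x"
  shows "R_map f c (J_set f u v) = (Some \<circ> g) |` ({u..v} - {c})"
proof -
  have ends: "e_minus c (J_set f u v) = a" "e_plus c (J_set f u v) = b"
    using Sup_J_left Inf_J_right by (simp_all add: e_minus_def e_plus_def)
  have lims: "right_lim (f ^^ n) c = u" "left_lim (f ^^ n) c = v"
    using tendsto_left[of n] tendsto_right[of n] n_ge_2 by (auto intro: right_lim_eqI left_lim_eqI)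
  show ?thesis
    using assms u_less_c c_less_v
    unfolding R_map_def ends first_hit_eq_n Let_def lims
    by (auto simp: restrict_map_def fun_eq_iff)
qed

lemma renormalization_return:
  assumes g_left: "\<And>x. x \<in> {u..<c} \<Longrightarrow> g x = (f ^^ n) x"
    and g_right: "\<And>x. x \<in> {c<..v} \<Longrightarrow> g x = (f ^^ n) x"
    and g: "lorenz_on u v g c"
  shows "renormalization f c n n u v g"
proof -
  \<comment> \<open>The convention for orbits that hit \<open>c\<close> changes nothing here:
    \<open>u\<close> lies in \<open>{a..<c}\<close> and \<open>v\<close> in \<open>{c<..b}\<close>,
    where the iterate is continuous.\<close>
  have lim: "right_lim (f ^^ n) u = (f ^^ n) u" "left_lim (f ^^ n) v = (f ^^ n) v"
  proof -
    obtain x where x: "u < x" "x < c" using dense u_less_c by blast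
    have "continuous_on {u..x} (f ^^ n)"
      using x a_le_u by (intro continuous_on_subset[OF continuous_left[of n]]) auto
    then show "right_lim (f ^^ n) u = (f ^^ n) u"
      using x by (intro right_lim_eqI continuous_on_Icc_at_rightD)
    obtain y where y: "c < y" "y < v" using dense c_less_v by blast
    have "continuous_on {y..v} (f ^^ n)"
      using y v_le_b by (intro continuous_on_subset[OF continuous_right[of n]]) auto
    then show "left_lim (f ^^ n) v = (f ^^ n) v"
      using y by (intro left_lim_eqI continuous_on_Icc_at_leftD)
  qed
  have "0 < u" "v < 1"
    using z_pos[of "n - k - 1"] z_less_1[of "n - k"] a_le_u v_le_b k by simp_all
  \<comment> \<open>The point \<open>u\<close> witnesses that the inclusion is proper.\<close>
  moreover from this have "u \<in> {0<..<1} - {u<..<v}" using u_less_c c by simp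
  ultimately have "{u<..<v} \<subset> {0<..<1}" by auto
  then show ?thesis
    unfolding renormalization_def expanding_lorenz_map_on_iff_lorenz_on
    using n_ge_2 u_less_c c_less_v g_left g_right g lim by simp
qed

end

theorem theorem3p5:
  fixes f g :: "real \<Rightarrow> real" and c u v :: real and n k :: nat and z :: "nat \<Rightarrow> real"
  assumes f: "expanding_lorenz_map f c"
    and z: "primary_nk_cycle f c n k z"
    and u: "u = (f ^^ (n - 1)) 0"
    and v: "v = (f ^^ (n - 1)) 1"
    and g_left: "\<forall>x\<in>{u..<c}. g x = (f ^^ n) x"
    and g_right: "\<forall>x\<in>{c<..v}. g x = (f ^^ n) x"
    and g_crit: "g c \<in> {u, v}"
  shows
    "(g ` {u..v} \<subseteq> {u..v} \<and> expanding_lorenz_map_on u v g c \<and> renormalization f c n n u v g) \<and>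
     (\<forall>l r u' v' g'. renormalization f c l r u' v' g' \<and> (l \<ge> n \<or> r \<ge> n) \<longrightarrow> n dvd l \<and> n dvd r) \<and>
     (z (k - 1) = f 0 \<or> z k = f 1 \<longrightarrow>
        \<not> completely_invariant (doubled_space f c) (hat_map f c) (hat_F_set f c n n)) \<and>
     (z (k - 1) \<noteq> f 0 \<and> z k \<noteq> f 1 \<longrightarrow>
        (completely_invariant {0..1} f (J_set f u v) \<and> J_set f u v \<subset> {0..1}) \<and>
        (z (n - k - 1) = Sup {x \<in> J_set f u v. x < c} \<and>
         z (n - k) = Inf {x \<in> J_set f u v. x > c}) \<and>
        R_map f c (J_set f u v) = (Some \<circ> g) |` ({u..v} - {c}))"
proof -
  have f01: "lorenz_on 0 1 f c" using f by (simp add: expanding_lorenz_map_iff_lorenz_on)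
  then obtain \<mu> where "lorenz f c \<mu>" by (rule lorenz_if_lorenz_on)
  then interpret primary_cycle f c \<mu> n k z
    using z by (simp add: primary_cycle_def primary_cycle_axioms_def)
  \<comment> \<open>The locale speaks of the iterates of 0 and 1, while \<open>u\<close> and
    \<open>v\<close> are variables here; the hypotheses on \<open>g\<close> are restated
    accordingly.\<close>
  have gl: "g x = (f ^^ n) x" if "x \<in> {(f ^^ (n - 1)) 0..<c}" for x using g_left that u by simp
  have gr: "g x = (f ^^ n) x" if "x \<in> {c<..(f ^^ (n - 1)) 1}" for x using g_right that v by simp
  have g: "lorenz_on u v g c"
    using lorenz_on_return[OF f01 gl gr] g_crit u v by simp
  have "n dvd l \<and> n dvd r"
    if ren: "renormalization f c l r u' v' g'" and ge: "l \<ge> n \<or> r \<ge> n" for l r u' v' g'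
  proof (rule return_times_dvd[OF _ _ ge])
    have g': "lorenz_on u' v' g' c" "\<And>x. x \<in> {u'<..<c} \<Longrightarrow> g' x = (f ^^ l) x"
        "\<And>x. x \<in> {c<..<v'} \<Longrightarrow> g' x = (f ^^ r) x"
      using ren unfolding renormalization_def expanding_lorenz_map_on_iff_lorenz_on by blast+
    show "left_return f c u' v' l"
      using g'(1,2) by (rule left_return_if_lorenz_on)
    \<comment> \<open>The right branch of the renormalization, with return time \<open>r\<close>, is
      the left branch of its reflection.\<close>
    show "left_return (reflect f) (1 - c) (1 - v') (1 - u') r"
      by (rule left_return_if_lorenz_on[OF lorenz_on_reflect[OF g'(1)]])
        (simp add: funpow_reflect, simp add: reflect_def g'(3))
  qed
  moreover have "g ` {u..v} \<subseteq> {u..v}" using g by (simp add: lorenz_on_def)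
  moreover have "renormalization f c n n u v g"
    using renormalization_return[OF gl gr] g u v by simp
  moreover have "J_set f u v \<subset> {0..1}"
  proof -
    have "c \<in> {0..1} - J_set f u v" using c_not_in_J c unfolding u v by simp
    moreover have "J_set f u v \<subseteq> {0..1}" by (auto simp: J_set_def)
    ultimately show ?thesis by blast
  qed
  ultimately show ?thesis
    using g J_completely_invariant Sup_J_left Inf_J_right R_map_J[OF gl gr]
      hat_F_not_completely_invariant
    unfolding u v expanding_lorenz_map_on_iff_lorenz_on by metis
qed

end
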